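(* Let $\{X_{k,n},\ 1\le k\le k(n)\}_{n\ge1}$ be an array of real-valued, square integrable, centered random variables, with $k(n)\to+\infty$, such that for each $n$ the variables $X_{1,n},\dots,X_{k(n),n}$ are independent, and put $S_n=\sum_{k=1}^{k(n)}X_{k,n}$. Let $F_{k,n}$ be the cumulative distribution function of $X_{k,n}$ and let $K_n$ be the distribution function given by $dK_n(x)=x^2\sum_{k=1}^{k(n)}dF_{k,n}(x)$. Suppose that the VCH and the UAN condition hold, and let $c$ be the limit in the VCH. Let $K$ be a distribution function such that $\mathcal K_K$ is the law of a random variable $Z$ with $\mathrm{Var}(Z)=c$. Then $$S_n\rightsquigarrow\mathcal K_K\quad\text{if and only if}\quad K_n\rightsquigarrow K.$$
   Context: VCH (Variance Convergence Hypothesis): $\sum_{k=1}^{k(n)}\mathrm{Var}(X_{k,n})\to c$ as $n\to+\infty$ for some $c\in]0,+\infty[$. UAN (Uniform Asymptotic Negligibility): for every $\varepsilon>0$, $\max_{1\le k\le k(n)}\mathbb P(|X_{k,n}|\ge\varepsilon)\to0$ as $n\to+\infty$. A distribution function (df) $K$ here is a bounded nondecreasing right-continuous function on $\mathbb R$; $\lambda_K$ is the associated finite Lebesgue–Stieltjes measure, $\lambda_K(]a,b])=K(b)-K(a)$, and a df is identified with its measure. $S_n\rightsquigarrow\mathcal K$ is convergence in distribution; $K_n\rightsquigarrow K$ is weak convergence of the bounded measures $\lambda_{K_n}$ to $\lambda_K$ (i.e. $\int f\,d\lambda_{K_n}\to\int f\,d\lambda_K$ for every bounded continuous $f$; equivalently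 $\lambda_{K_n}(]a,b])\to\lambda_K(]a,b])$ for all continuity points $a<b$ of $K$ and $\lambda_{K_n}(\mathbb R)\to\lambda_K(\mathbb R)$). For a df $K$, $\mathcal K_K$ is the probability law with characteristic function $\exp(\Psi_K)$, where $\Psi_K(u)=\int\frac{e^{iux}-1-iux}{x^2}\,dK(x)$, the integrand being taken as $-u^2/2$ at $x=0$. *)

theory Defs
  imports "HOL-Probability.Probability"
begin

definition distribution_function :: "(real \<Rightarrow> real) \<Rightarrow> bool" where
  "distribution_function K \<longleftrightarrow>
     mono K \<and> bounded (range K) \<and> (\<forall>x. continuous (at_right x) K)"

text \<open>The finite Lebesgue--Stieltjes measure \<open>\<lambda>\<^sub>K\<close> of a distribution function \<open>K\<close> is
  \<open>interval_measure K\<close>. Its total mass need not be 1, so the library's \<open>weak_conv\<close>,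
  which only looks at continuity points and ignores mass escaping to infinity, is not the right
  notion here.\<close>

definition weak_conv_df :: "(nat \<Rightarrow> real \<Rightarrow> real) \<Rightarrow> (real \<Rightarrow> real) \<Rightarrow> bool" where
  "weak_conv_df Kseq K \<longleftrightarrow>
     (\<forall>f :: real \<Rightarrow> real. continuous_on UNIV f \<longrightarrow> bounded (range f) \<longrightarrow>
        (\<lambda>n. LINT x|interval_measure (Kseq n). f x) \<longlonglongrightarrow> (LINT x|interval_measure K. f x))"

definition Psi :: "(real \<Rightarrow> real) \<Rightarrow> real \<Rightarrow> complex" where
  "Psi K u =
     (CLINT x|interval_measure K.
        (if x = 0 then - (complex_of_real u)\<^sup>2 / 2
         else (iexp (u * x) - 1 - \<i> * complex_of_real (u * x)) / (complex_of_real x)\<^sup>2))"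

text \<open>\<open>is_K_law K P\<close> says that \<open>P\<close> is the probability law with characteristic function
  \<open>exp (Psi K)\<close>. There is at most one such \<open>P\<close>, by \<open>Levy_uniqueness\<close>.\<close>

definition is_K_law :: "(real \<Rightarrow> real) \<Rightarrow> real measure \<Rightarrow> bool" where
  "is_K_law K P \<longleftrightarrow> real_distribution P \<and> (\<forall>u. char P u = exp (Psi K u))"

text \<open>In the following, \<open>X k n\<close>, for \<open>k \<in> {1..m n}\<close>, are the variables of the \<open>n\<close>-th row of an
  array, defined on the space \<open>M n\<close>.\<close>

definition row_cdf ::
    "(nat \<Rightarrow> 'a measure) \<Rightarrow> (nat \<Rightarrow> nat \<Rightarrow> 'a \<Rightarrow> real) \<Rightarrow> nat \<Rightarrow> nat \<Rightarrow> real \<Rightarrow> real" where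
  "row_cdf M X k n = cdf (distr (M n) borel (X k n))"

text \<open>The function \<open>K\<^sub>n\<close> with \<open>dK\<^sub>n(x) = x\<^sup>2 \<Sum>\<^sub>k dF\<^sub>k\<^sub>,\<^sub>n(x)\<close>, normalised to vanish at
  \<open>- \<infinity>\<close>; only its increments matter.\<close>

definition row_K ::
    "(nat \<Rightarrow> 'a measure) \<Rightarrow> (nat \<Rightarrow> nat) \<Rightarrow> (nat \<Rightarrow> nat \<Rightarrow> 'a \<Rightarrow> real) \<Rightarrow> nat \<Rightarrow> real \<Rightarrow> real"
  where
  "row_K M m X n x =
     (\<Sum>k=1..m n. LINT y:{..x}|interval_measure (row_cdf M X k n). y\<^sup>2)"

definition VCH ::
    "(nat \<Rightarrow> 'a measure) \<Rightarrow> (nat \<Rightarrow> nat) \<Rightarrow> (nat \<Rightarrow> nat \<Rightarrow> 'a \<Rightarrow> real) \<Rightarrow> real \<Rightarrow> bool" where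
  "VCH M m X c \<longleftrightarrow>
     0 < c \<and> (\<lambda>n. \<Sum>k=1..m n. prob_space.variance (M n) (X k n)) \<longlonglongrightarrow> c"

text \<open>For the finitely many \<open>n\<close> at which a row might be empty, the value of \<open>MAX\<close> is
  irrelevant to the limit.\<close>

definition UAN ::
    "(nat \<Rightarrow> 'a measure) \<Rightarrow> (nat \<Rightarrow> nat) \<Rightarrow> (nat \<Rightarrow> nat \<Rightarrow> 'a \<Rightarrow> real) \<Rightarrow> bool" where
  "UAN M m X \<longleftrightarrow>
     (\<forall>\<epsilon>>0. (\<lambda>n. MAX k\<in>{1..m n}. measure (M n) {\<omega> \<in> space (M n). \<bar>X k n \<omega>\<bar> \<ge> \<epsilon>})
        \<longlonglongrightarrow> 0)"

end

theory Submission
  imports Defs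
begin

text \<open>
  Write \<open>\<kappa>\<^sub>n\<close> for the measure of \<open>K\<^sub>n\<close>, \<open>\<mu>\<close> for that of \<open>K\<close>, and \<open>psi \<kappa> u\<close> for the integral
  of \<open>kern u x = (e\<^sup>i\<^sup>u\<^sup>x - 1 - iux) / x\<^sup>2\<close> against a finite measure \<open>\<kappa>\<close>.

  The bridge between \<open>S\<^sub>n\<close> and \<open>\<kappa>\<^sub>n\<close> is Poissonisation. The variables are centered, so their
  characteristic functions satisfy \<open>\<Sum>\<^sub>k (\<phi>\<^sub>k - 1) = psi \<kappa>\<^sub>n u\<close>. Replacing each factor \<open>\<phi>\<^sub>k\<close> by
  \<open>exp (\<phi>\<^sub>k - 1)\<close> costs at most a multiple of \<open>\<Sum>\<^sub>k \<bar>\<phi>\<^sub>k - 1\<bar>\<^sup>2\<close>. Here the UAN condition makes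
  \<open>max\<^sub>k \<bar>\<phi>\<^sub>k - 1\<bar>\<close> small and the VCH bounds \<open>\<Sum>\<^sub>k \<bar>\<phi>\<^sub>k - 1\<bar>\<close>, so the characteristic function of \<open>S\<^sub>n\<close>
  differs from \<open>exp (psi \<kappa>\<^sub>n u)\<close> by a null sequence (\<open>char_row_sum_minus_exp_psi_tendsto_0\<close>).
  By the Levy continuity theorem, \<open>S\<^sub>n\<close> converges to the law of \<open>K\<close> iff
  \<open>exp (psi \<kappa>\<^sub>n u) \<longlonglongrightarrow> exp (psi \<mu> u)\<close> for all \<open>u\<close>, and the probability is gone from the problem.

  If \<open>\<kappa>\<^sub>n\<close> converges weakly to \<open>\<mu>\<close>, the exponents converge because \<open>kern u\<close> is bounded and
  continuous.

  For the converse (\<open>weak_conv_of_exp_psi\<close>), the exponentials are first removed: the exponents are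
  locally Lipschitz in \<open>u\<close>, uniformly in \<open>n\<close>, and vanish at \<open>u = 0\<close>, so they are the right branches of the
  logarithm and converge themselves. Second differences in \<open>u\<close> with step \<open>h\<close> turn \<open>psi \<kappa>\<close> into
  the characteristic function of the measure \<open>fejer h x d\<kappa>(x)\<close>, where
  \<open>fejer h x = 2 (1 - cos (h x)) / x\<^sup>2\<close>. Hence \<open>fejer h d\<kappa>\<^sub>n\<close> converges weakly to \<open>fejer h d\<mu>\<close> for each
  \<open>h\<close>. Finally \<open>fejer h / h\<^sup>2\<close> lies in \<open>[0,1]\<close> and tends to 1 as \<open>h \<longlonglongrightarrow> 0\<close>. The mass that this
  weight removes from \<open>\<kappa>\<^sub>n\<close> is, in the limit, the mass that it removes from \<open>\<mu>\<close>, provided that the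
  total masses converge; it is therefore uniformly small and the weight can be dropped.

  The total mass of \<open>\<kappa>\<^sub>n\<close> is the variance of the row sum, which tends to \<open>c\<close>. That \<open>\<mu>\<close> has mass
  \<open>c\<close> is what the hypothesis on \<open>Z\<close> gives: the variance of a law with characteristic function
  \<open>exp (psi \<mu> u)\<close> is the mass of \<open>\<mu>\<close> (\<open>variance_eq_mass\<close>).
\<close>

section \<open>The kernel of the canonical representation\<close>

definition kern :: "real \<Rightarrow> real \<Rightarrow> complex" where
  "kern u x = (if x = 0 then - (complex_of_real u)\<^sup>2 / 2
     else (iexp (u * x) - 1 - \<i> * complex_of_real (u * x)) / (complex_of_real x)\<^sup>2)"

text \<open>The exponent is taken of a measure rather than of a distribution function, so that it applies
  to the measure of \<open>K\<close> and to those of the \<open>K\<^sub>n\<close> alike.\<close>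

definition psi :: "real measure \<Rightarrow> real \<Rightarrow> complex" where
  "psi \<mu> u = (CLINT x|\<mu>. kern u x)"

lemma Psi_eq_psi: "Psi K = psi (interval_measure K)"
  by (simp add: fun_eq_iff Psi_def psi_def kern_def)

lemma kern_0 [simp]: "kern 0 x = 0"
  by (simp add: kern_def)

lemma kern_measurable [measurable]: "kern u \<in> borel_measurable borel"
  unfolding kern_def by measurable

lemma iexp_linear_bound: "cmod (iexp y - 1 - \<i> * complex_of_real y) \<le> y\<^sup>2 / 2"
  using iexp_approx1[of y 1] by (simp add: eval_nat_numeral algebra_simps)

lemma iexp_quadratic_bound:
  "cmod (iexp y - 1 - \<i> * complex_of_real y + complex_of_real (y\<^sup>2 / 2)) \<le> \<bar>y\<bar> ^ 3 / 6"
  using iexp_approx1[of y 2]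
  by (simp add: eval_nat_numeral algebra_simps fact_numeral)

lemma kern_mult_square:
  "kern u x * (complex_of_real x)\<^sup>2 = iexp (u * x) - 1 - \<i> * complex_of_real (u * x)"
  by (simp add: kern_def)

lemma norm_kern_le: "cmod (kern u x) \<le> u\<^sup>2 / 2"
proof (cases "x = 0")
  case False
  have "cmod (kern u x) = cmod (iexp (u * x) - 1 - \<i> * complex_of_real (u * x)) / x\<^sup>2"
    using False by (simp add: kern_def norm_divide norm_power)
  also have "\<dots> \<le> ((u * x)\<^sup>2 / 2) / x\<^sup>2"
    by (intro divide_right_mono iexp_linear_bound) simp
  finally show ?thesis
    using False by (simp add: field_simps)
qed (simp add: kern_def norm_divide norm_power)

lemma kern_near_0: "cmod (kern u x + complex_of_real (u\<^sup>2 / 2)) \<le> \<bar>u\<bar> ^ 3 * \<bar>x\<bar> / 6"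
proof (cases "x = 0")
  case False
  have "kern u x + complex_of_real (u\<^sup>2 / 2) =
      (iexp (u * x) - 1 - \<i> * complex_of_real (u * x) + complex_of_real ((u * x)\<^sup>2 / 2)) / (complex_of_real x)\<^sup>2"
    using False by (simp add: kern_def field_simps power2_eq_square)
  then have "cmod (kern u x + complex_of_real (u\<^sup>2 / 2)) =
      cmod (iexp (u * x) - 1 - \<i> * complex_of_real (u * x) + complex_of_real ((u * x)\<^sup>2 / 2)) / x\<^sup>2"
    by (simp add: norm_divide norm_power)
  also have "\<dots> \<le> (\<bar>u * x\<bar> ^ 3 / 6) / x\<^sup>2"
    by (intro divide_right_mono iexp_quadratic_bound) simp
  also have "\<dots> = \<bar>u\<bar> ^ 3 * \<bar>x\<bar> / 6"
    using False by (simp add: abs_mult power_mult_distrib power2_eq_square power3_eq_cube field_simps)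
  finally show ?thesis .
qed (simp add: kern_def)

lemma kern_isCont: "isCont (kern u) x"
proof (cases "x = 0")
  case True
  have "((\<lambda>y. kern u y + complex_of_real (u\<^sup>2 / 2)) \<longlongrightarrow> 0) (at 0)"
  proof (rule Lim_null_comparison)
    show "\<forall>\<^sub>F y in at 0. cmod (kern u y + complex_of_real (u\<^sup>2 / 2)) \<le> \<bar>u\<bar> ^ 3 * \<bar>y\<bar> / 6"
      by (intro always_eventually allI kern_near_0)
    show "((\<lambda>y. \<bar>u\<bar> ^ 3 * \<bar>y\<bar> / 6) \<longlongrightarrow> 0) (at 0)"
      by (auto intro!: tendsto_eq_intros)
  qed
  then have "((\<lambda>y. kern u y + complex_of_real (u\<^sup>2 / 2) - complex_of_real (u\<^sup>2 / 2)) \<longlongrightarrow>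
      0 - complex_of_real (u\<^sup>2 / 2)) (at 0)"
    by (intro tendsto_intros)
  then show ?thesis
    by (simp add: True isCont_def kern_def[of u 0])
next
  case False
  have "isCont (\<lambda>y. (iexp (u * y) - 1 - \<i> * complex_of_real (u * y)) / (complex_of_real y)\<^sup>2) x"
    using False by (intro continuous_intros) auto
  moreover have "\<forall>\<^sub>F y in nhds x. kern u y =
      (iexp (u * y) - 1 - \<i> * complex_of_real (u * y)) / (complex_of_real y)\<^sup>2"
    using t1_space_nhds[OF False] by eventually_elim (simp add: kern_def)
  ultimately show ?thesis
    by (simp add: isCont_cong)
qed

lemma bounded_range_kern: "bounded (range (kern u))"
  unfolding bounded_iff using norm_kern_le by blast

text \<open>Division by \<open>x\<^sup>2\<close> is harmless because, with \<open>d = u - v\<close>, the numerator of the difference is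
  \<open>(e\<^sup>i\<^sup>d\<^sup>x - 1 - idx) + (e\<^sup>i\<^sup>v\<^sup>x - 1) (e\<^sup>i\<^sup>d\<^sup>x - 1)\<close>, and both terms vanish to second order in \<open>x\<close>.\<close>

lemma kern_diff_bound: "cmod (kern u x - kern v x) \<le> \<bar>u - v\<bar> * (\<bar>u - v\<bar> / 2 + \<bar>v\<bar>)"
proof (cases "x = 0")
  case True
  have "complex_of_real (v\<^sup>2 / 2 - u\<^sup>2 / 2) = kern u x - kern v x"
    by (simp add: True kern_def)
  then have "cmod (kern u x - kern v x) = \<bar>v\<^sup>2 / 2 - u\<^sup>2 / 2\<bar>"
    by (metis norm_of_real)
  also have "v\<^sup>2 / 2 - u\<^sup>2 / 2 = - ((u - v) * ((u - v) / 2 + v))"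
    by (simp add: field_simps power2_eq_square)
  also have "\<bar>- ((u - v) * ((u - v) / 2 + v))\<bar> = \<bar>u - v\<bar> * \<bar>(u - v) / 2 + v\<bar>"
    by (simp only: abs_minus_cancel abs_mult)
  also have "\<dots> \<le> \<bar>u - v\<bar> * (\<bar>u - v\<bar> / 2 + \<bar>v\<bar>)"
    by (intro mult_left_mono order_trans[OF abs_triangle_ineq]) auto
  finally show ?thesis .
next
  case False
  define d where "d = u - v"
  have u: "u = v + d"
    by (simp add: d_def)
  have "(kern u x - kern v x) * (complex_of_real x)\<^sup>2 =
      (iexp (d * x) - 1 - \<i> * complex_of_real (d * x)) + (iexp (v * x) - 1) * (iexp (d * x) - 1)"
    by (simp add: u kern_mult_square left_diff_distrib distrib_left exp_add algebra_simps)
  then have "cmod (kern u x - kern v x) * x\<^sup>2 =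
      cmod ((iexp (d * x) - 1 - \<i> * complex_of_real (d * x)) + (iexp (v * x) - 1) * (iexp (d * x) - 1))"
    by (metis norm_mult norm_power norm_of_real power2_abs)
  also have "\<dots> \<le> cmod (iexp (d * x) - 1 - \<i> * complex_of_real (d * x)) +
      cmod (iexp (v * x) - 1) * cmod (iexp (d * x) - 1)"
    by (metis norm_mult norm_triangle_ineq)
  also have "\<dots> \<le> (d * x)\<^sup>2 / 2 + \<bar>v * x\<bar> * \<bar>d * x\<bar>"
    using iexp_approx1[of "v * x" 0] iexp_approx1[of "d * x" 0]
    by (intro add_mono iexp_linear_bound mult_mono) auto
  also have "\<dots> = (\<bar>d\<bar> * (\<bar>d\<bar> / 2 + \<bar>v\<bar>)) * x\<^sup>2"
    by (simp add: abs_mult algebra_simps power_mult_distrib power2_eq_square abs_mult_self_eq)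
  finally show ?thesis
    using False by (simp add: d_def)
qed

text \<open>This is \<open>2 (1 - cos (h x)) / x\<^sup>2\<close>, the Fejer kernel, with value \<open>h\<^sup>2\<close> at 0. Expressed through
  \<open>kern\<close>, it inherits measurability, the bound by \<open>h\<^sup>2\<close> and the behaviour near 0.\<close>

definition fejer :: "real \<Rightarrow> real \<Rightarrow> real" where
  "fejer h x = - 2 * Re (kern h x)"

lemma fejer_measurable [measurable]: "fejer h \<in> borel_measurable borel"
  unfolding fejer_def by measurable

text \<open>The linear term of \<open>kern\<close> cancels in a second difference, which leaves a pure exponential with a
  nonnegative weight. This is what brings characteristic functions of positive measures into play.\<close>

lemma kern_second_difference:
  "kern (u + h) x + kern (u - h) x - 2 * kern u x = - complex_of_real (fejer h x) * iexp (u * x)"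
proof (cases "x = 0")
  case True
  then show ?thesis
    by (simp add: fejer_def kern_def field_simps power2_eq_square)
next
  case False
  have r: "complex_of_real (fejer h x) * (complex_of_real x)\<^sup>2 = complex_of_real (- 2 * (cos (h * x) - 1))"
  proof -
    have "fejer h x * x\<^sup>2 = - 2 * Re (kern h x * (complex_of_real x)\<^sup>2)"
      by (simp add: fejer_def flip: of_real_power)
    also have "\<dots> = - 2 * (cos (h * x) - 1)"
      by (simp only: kern_mult_square) (simp add: Re_exp)
    finally show ?thesis
      by (metis of_real_mult of_real_power)
  qed
  have c: "complex_of_real (cos (h * x)) = (iexp (h * x) + iexp (- (h * x))) / 2"
    by (simp add: complex_eq_iff Re_exp Im_exp)
  have "(kern (u + h) x + kern (u - h) x - 2 * kern u x) * (complex_of_real x)\<^sup>2 =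
     iexp (u * x) * iexp (h * x) + iexp (u * x) * iexp (- (h * x)) - 2 * iexp (u * x)"
    by (simp add: left_diff_distrib distrib_right kern_mult_square distrib_left right_diff_distrib
        mult.assoc flip: exp_add)
  also have "\<dots> = - (complex_of_real (fejer h x) * (complex_of_real x)\<^sup>2) * iexp (u * x)"
    unfolding r of_real_mult of_real_diff c by (simp add: field_simps)
  finally have "(kern (u + h) x + kern (u - h) x - 2 * kern u x) * (complex_of_real x)\<^sup>2 =
      (- complex_of_real (fejer h x) * iexp (u * x)) * (complex_of_real x)\<^sup>2"
    by (simp add: mult.assoc mult.commute[of "iexp (u * x)"])
  then show ?thesis
    using False by (simp only: mult_cancel_right power_eq_0_iff of_real_eq_0_iff simp_thms zero_neq_numeral)
qed

lemma fejer_nonneg: "0 \<le> fejer h x"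
proof (cases "x = 0")
  case False
  have "Re (kern h x) = (cos (h * x) - 1) / x\<^sup>2"
    using False by (simp add: kern_def Re_exp flip: of_real_power)
  then show ?thesis
    using False by (simp add: fejer_def divide_nonpos_pos)
qed (simp add: fejer_def kern_def flip: of_real_power)

lemma fejer_le: "fejer h x \<le> h\<^sup>2"
  using norm_kern_le[of h x] abs_Re_le_cmod[of "kern h x"] by (simp add: fejer_def)

lemma fejer_approx: "\<bar>fejer h x - h\<^sup>2\<bar> \<le> \<bar>h\<bar> ^ 3 * \<bar>x\<bar> / 3"
proof -
  have "fejer h x - h\<^sup>2 = - 2 * Re (kern h x + complex_of_real (h\<^sup>2 / 2))"
    by (simp add: fejer_def)
  then have "\<bar>fejer h x - h\<^sup>2\<bar> = 2 * \<bar>Re (kern h x + complex_of_real (h\<^sup>2 / 2))\<bar>"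
    by (simp only: abs_mult abs_minus_cancel abs_numeral)
  also have "\<dots> \<le> 2 * cmod (kern h x + complex_of_real (h\<^sup>2 / 2))"
    by (intro mult_left_mono abs_Re_le_cmod) simp
  finally show ?thesis
    using kern_near_0[of h x] by simp
qed

lemma fejer_ratio_bounds: "0 \<le> fejer h x / h\<^sup>2" "fejer h x / h\<^sup>2 \<le> 1"
  using fejer_nonneg[of h x] fejer_le[of h x] by (auto simp: divide_le_eq)

lemma fejer_ratio_tendsto:
  assumes "h \<longlonglongrightarrow> 0" "\<And>j. h j \<noteq> 0"
  shows "(\<lambda>j. fejer (h j) x / (h j)\<^sup>2) \<longlonglongrightarrow> 1"
proof -
  have "(\<lambda>j. fejer (h j) x / (h j)\<^sup>2 - 1) \<longlonglongrightarrow> 0"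
  proof (rule Lim_null_comparison)
    have "\<bar>fejer (h j) x / (h j)\<^sup>2 - 1\<bar> \<le> \<bar>h j\<bar> * \<bar>x\<bar> / 3" for j
    proof -
      have "\<bar>fejer (h j) x / (h j)\<^sup>2 - 1\<bar> = \<bar>fejer (h j) x - (h j)\<^sup>2\<bar> / (h j)\<^sup>2"
      proof -
        have "fejer (h j) x / (h j)\<^sup>2 - 1 = (fejer (h j) x - (h j)\<^sup>2) / (h j)\<^sup>2"
          using assms(2)[of j] by (simp add: diff_divide_distrib)
        then show ?thesis
          by (simp only: abs_divide abs_power2)
      qed
      also have "\<dots> \<le> (\<bar>h j\<bar> ^ 3 * \<bar>x\<bar> / 3) / (h j)\<^sup>2"
        by (intro divide_right_mono fejer_approx) simp
      also have "\<dots> = \<bar>h j\<bar> * \<bar>x\<bar> / 3"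
        using assms(2)[of j] by (simp add: power3_eq_cube power2_eq_square)
      finally show ?thesis .
    qed
    then show "\<forall>\<^sub>F j in sequentially. norm (fejer (h j) x / (h j)\<^sup>2 - 1) \<le> \<bar>h j\<bar> * \<bar>x\<bar> / 3"
      by simp
    show "(\<lambda>j. \<bar>h j\<bar> * \<bar>x\<bar> / 3) \<longlonglongrightarrow> 0"
      using assms(1) by (auto intro!: tendsto_eq_intros)
  qed
  then show ?thesis
    by (simp add: LIM_zero_iff)
qed

section \<open>Finite measures on the line\<close>

lemma norm_integral_le_integral:
  fixes f :: "'a \<Rightarrow> 'b::{banach, second_countable_topology}"
  assumes "integrable M f" "integrable M g" "\<And>x. x \<in> space M \<Longrightarrow> norm (f x) \<le> g x"
  shows "norm (integral\<^sup>L M f) \<le> integral\<^sup>L M g"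
  using assms by (intro order_trans[OF integral_norm_bound integral_mono]) auto

lemma (in finite_borel_measure) integrable_bounded:
  fixes f :: "real \<Rightarrow> 'b::{banach, second_countable_topology}"
  assumes "f \<in> borel_measurable borel" "\<And>x. norm (f x) \<le> B"
  shows "integrable M f"
  by (rule integrable_const_bound[of _ B]) (use assms in \<open>auto simp: measurable_cong_sets[OF M_is_borel refl]\<close>)

lemma (in finite_borel_measure) integrable_kern: "integrable M (kern u)"
  by (rule integrable_bounded[OF kern_measurable norm_kern_le])

lemma (in finite_borel_measure) psi_lipschitz:
  "cmod (psi M u - psi M v) \<le> measure M UNIV * (\<bar>u - v\<bar> * (\<bar>u - v\<bar> / 2 + \<bar>v\<bar>))"
proof -
  have "psi M u - psi M v = (CLINT x|M. kern u x - kern v x)"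
    unfolding psi_def by (intro Bochner_Integration.integral_diff[symmetric] integrable_kern)
  also have "cmod \<dots> \<le> (LINT x|M. \<bar>u - v\<bar> * (\<bar>u - v\<bar> / 2 + \<bar>v\<bar>))"
    by (rule norm_integral_le_integral)
       (auto intro: integrable_kern kern_diff_bound)
  finally show ?thesis
    by (simp add: borel_UNIV)
qed

lemma (in finite_borel_measure) psi_second_difference:
  "psi M (u + h) + psi M (u - h) - 2 * psi M u = - (CLINT x|M. complex_of_real (fejer h x) * iexp (u * x))"
proof -
  have "psi M (u + h) + psi M (u - h) - 2 * psi M u =
      (CLINT x|M. kern (u + h) x + kern (u - h) x - 2 * kern u x)"
    unfolding psi_def using integrable_kern by simp
  then show ?thesis
    by (simp add: kern_second_difference)
qed

lemma (in finite_borel_measure) psi_0: "psi M 0 = 0"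
  by (simp add: psi_def)

lemma (in finite_borel_measure) integral_fejer_ratio_tendsto:
  assumes "h \<longlonglongrightarrow> 0" "\<And>j. h j \<noteq> 0"
  shows "(\<lambda>j. LINT x|M. fejer (h j) x / (h j)\<^sup>2) \<longlonglongrightarrow> measure M UNIV"
proof -
  have "(\<lambda>j. LINT x|M. fejer (h j) x / (h j)\<^sup>2) \<longlonglongrightarrow> (LINT x|M. 1)"
    by (rule integral_dominated_convergence[where w="\<lambda>_. 1"])
       (auto simp: measurable_cong_sets[OF M_is_borel refl] fejer_nonneg abs_of_nonneg fejer_ratio_bounds
          intro!: fejer_ratio_tendsto assms)
  then show ?thesis
    by (simp add: borel_UNIV)
qed

section \<open>Continuity theorem for finite measures\<close>

lemma (in finite_borel_measure) char_0: "char M 0 = complex_of_real (measure M UNIV)"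
  by (simp add: char_def borel_UNIV scaleR_conv_of_real)

lemma (in finite_borel_measure) real_distribution_normalise:
  assumes "measure M UNIV > 0"
  shows "real_distribution (density M (\<lambda>_. ennreal (1 / measure M UNIV)))"
proof -
  have "emeasure (density M (\<lambda>_. ennreal (1 / measure M UNIV))) UNIV =
      ennreal (1 / measure M UNIV) * emeasure M UNIV"
    by (subst emeasure_density) (auto simp: M_is_borel borel_UNIV)
  also have "\<dots> = 1"
    using assms by (simp add: emeasure_eq_measure flip: ennreal_mult)
  finally have "prob_space (density M (\<lambda>_. ennreal (1 / measure M UNIV)))"
    by (intro prob_spaceI) (simp add: borel_UNIV)
  then show ?thesis
    by (simp add: real_distribution_def real_distribution_axioms_def M_is_borel)
qed

lemma (in finite_borel_measure) integral_normalise: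
  fixes f :: "real \<Rightarrow> 'b::{banach, second_countable_topology}"
  assumes "f \<in> borel_measurable borel"
  shows "integral\<^sup>L (density M (\<lambda>_. ennreal (1 / measure M UNIV))) f = integral\<^sup>L M f /\<^sub>R measure M UNIV"
  using assms by (subst integral_density) (auto simp: measurable_cong_sets[OF M_is_borel refl] inverse_eq_divide)

text \<open>Dividing by the total mass reduces this to the Levy continuity theorem for probability measures.
  The masses converge, being the characteristic functions at 0. If the limit has mass 0, there is
  nothing to normalise, but then all the integrals tend to 0.\<close>

lemma levy_continuity_finite:
  fixes \<mu> :: "nat \<Rightarrow> real measure" and f :: "real \<Rightarrow> real"
  assumes \<mu>: "\<And>n. finite_borel_measure (\<mu> n)" and M: "finite_borel_measure M"
    and char: "\<And>u. (\<lambda>n. char (\<mu> n) u) \<longlonglongrightarrow> char M u"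
    and f: "\<And>x. isCont f x" "\<And>x. \<bar>f x\<bar> \<le> B"
  shows "(\<lambda>n. integral\<^sup>L (\<mu> n) f) \<longlonglongrightarrow> integral\<^sup>L M f"
proof -
  interpret \<mu>: finite_borel_measure "\<mu> n" for n by (rule \<mu>)
  interpret M: finite_borel_measure M by (rule M)
  have f_borel: "f \<in> borel_measurable borel"
    using f(1) by (intro borel_measurable_continuous_onI continuous_at_imp_continuous_on) auto
  have mass: "(\<lambda>n. measure (\<mu> n) UNIV) \<longlonglongrightarrow> measure M UNIV"
    using char[of 0] by (simp add: \<mu>.char_0 M.char_0 tendsto_of_real_iff)
  show ?thesis
  proof (cases "measure M UNIV = 0")
    case True
    have bound: "\<bar>integral\<^sup>L N f\<bar> \<le> B * measure N UNIV" if "finite_borel_measure N" for N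
    proof -
      interpret N: finite_borel_measure N by (rule that)
      have "norm (integral\<^sup>L N f) \<le> (LINT x|N. B)"
        using f by (intro norm_integral_le_integral N.integrable_bounded[OF f_borel]) auto
      then show ?thesis
        by (simp add: N.borel_UNIV mult.commute)
    qed
    have "(\<lambda>n. integral\<^sup>L (\<mu> n) f) \<longlonglongrightarrow> 0"
    proof (rule Lim_null_comparison)
      show "\<forall>\<^sub>F n in sequentially. norm (integral\<^sup>L (\<mu> n) f) \<le> B * measure (\<mu> n) UNIV"
        using bound[OF \<mu>] by simp
      show "(\<lambda>n. B * measure (\<mu> n) UNIV) \<longlonglongrightarrow> 0"
        using tendsto_mult_left[OF mass, of B] by (simp add: True)
    qed
    moreover have "integral\<^sup>L M f = 0"
      using bound[OF M] by (simp add: True)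
    ultimately show ?thesis
      by simp
  next
    case False
    then have pos: "measure M UNIV > 0"
      by (simp add: zero_less_measure_iff)
    \<comment> \<open>Finitely many \<open>\<mu> n\<close> may be null; they are replaced by \<open>M\<close> so that every term can be normalised.\<close>
    define \<rho> where "\<rho> n = (if measure (\<mu> n) UNIV > 0 then \<mu> n else M)" for n
    define norml where "norml N = density N (\<lambda>_. ennreal (1 / measure N UNIV))" for N :: "real measure"
    have \<rho>: "finite_borel_measure (\<rho> n)" and \<rho>_pos: "measure (\<rho> n) UNIV > 0" for n
      using \<mu> M pos by (auto simp: \<rho>_def)
    interpret \<rho>: finite_borel_measure "\<rho> n" for n by (rule \<rho>)
    have ev: "\<forall>\<^sub>F n in sequentially. \<rho> n = \<mu> n"
      using order_tendstoD(1)[OF mass pos] by eventually_elim (simp add: \<rho>_def)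
    have mass\<rho>: "(\<lambda>n. measure (\<rho> n) UNIV) \<longlonglongrightarrow> measure M UNIV"
      using mass by (rule Lim_transform_eventually) (use ev in eventually_elim, simp)
    have distr: "real_distribution (norml (\<rho> n))" "real_distribution (norml M)" for n
      unfolding norml_def using \<rho>.real_distribution_normalise \<rho>_pos M.real_distribution_normalise pos by auto
    have "weak_conv_m (\<lambda>n. norml (\<rho> n)) (norml M)"
    proof (rule levy_continuity)
      fix u
      have "(\<lambda>n. char (\<rho> n) u) \<longlonglongrightarrow> char M u"
        using char by (rule Lim_transform_eventually) (use ev in eventually_elim, simp)
      then have "(\<lambda>n. char (\<rho> n) u /\<^sub>R measure (\<rho> n) UNIV) \<longlonglongrightarrow> char M u /\<^sub>R measure M UNIV"
        using mass\<rho> False by (intro tendsto_intros)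
      then show "(\<lambda>n. char (norml (\<rho> n)) u) \<longlonglongrightarrow> char (norml M) u"
        by (simp add: char_def norml_def \<rho>.integral_normalise M.integral_normalise)
    qed (rule distr)+
    then have "(\<lambda>n. integral\<^sup>L (norml (\<rho> n)) f) \<longlonglongrightarrow> integral\<^sup>L (norml M) f"
      using distr f by (intro weak_conv_imp_integral_bdd_continuous_conv[where B=B]) auto
    then have "(\<lambda>n. measure (\<rho> n) UNIV * integral\<^sup>L (norml (\<rho> n)) f) \<longlonglongrightarrow>
        measure M UNIV * integral\<^sup>L (norml M) f"
      by (intro tendsto_intros mass\<rho>)
    then have "(\<lambda>n. integral\<^sup>L (\<rho> n) f) \<longlonglongrightarrow> integral\<^sup>L M f"
      using less_imp_neq[OF \<rho>_pos] pos
      by (simp add: norml_def \<rho>.integral_normalise M.integral_normalise f_borel flip: mult.assoc)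
    then show ?thesis
      by (rule Lim_transform_eventually) (use ev in eventually_elim, simp)
  qed
qed

section \<open>Continuous logarithms\<close>

text \<open>The value of \<open>exp (D n s)\<close> determines \<open>D n s\<close> only up to multiples of \<open>2 \<pi> i\<close>. The path starts at
  0, and a grid of width at most \<open>1 / C\<close> is so fine that \<open>D n\<close> moves by at most 1 from one
  point to the next. So if \<open>D n\<close> is small at one grid point, then at the next one it stays in the
  strip where the principal logarithm inverts the exponential.\<close>

lemma exp_tendsto_1_imp_tendsto_0:
  fixes D :: "nat \<Rightarrow> real \<Rightarrow> complex"
  assumes D_0: "\<And>n. D n 0 = 0"
    and exp: "\<And>s. s \<in> {0..1} \<Longrightarrow> (\<lambda>n. exp (D n s)) \<longlonglongrightarrow> 1"
    and lipschitz: "\<And>n s t. s \<in> {0..1} \<Longrightarrow> t \<in> {0..1} \<Longrightarrow> cmod (D n s - D n t) \<le> C * \<bar>s - t\<bar>"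
  shows "(\<lambda>n. D n 1) \<longlonglongrightarrow> 0"
proof -
  define N where "N = Suc (nat \<lceil>C\<rceil>)"
  have N: "C / real N \<le> 1" "real N > 0"
    by (auto simp: N_def divide_le_eq) linarith
  have "j \<le> N \<Longrightarrow> (\<lambda>n. D n (real j / real N)) \<longlonglongrightarrow> 0" for j
  proof (induction j)
    case (Suc j)
    define s t where "s = real j / real N" and "t = real (Suc j) / real N"
    have st: "s \<in> {0..1}" "t \<in> {0..1}" "\<bar>t - s\<bar> = 1 / real N"
      using Suc.prems N by (auto simp: s_def t_def divide_le_eq simp flip: diff_divide_distrib)
    have "\<forall>\<^sub>F n in sequentially. cmod (D n s) < 1"
      using Suc.IH Suc.prems order_tendstoD(2)[OF tendsto_norm, of "\<lambda>n. D n s" 0] by (simp add: s_def)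
    then have "\<forall>\<^sub>F n in sequentially. Ln (exp (D n t)) = D n t"
    proof eventually_elim
      case (elim n)
      have "cmod (D n t) \<le> cmod (D n t - D n s) + cmod (D n s)"
        by (metis diff_add_cancel norm_triangle_ineq)
      also have "cmod (D n t - D n s) \<le> 1"
        using lipschitz[OF st(2,1), of n] N(1) by (simp add: st(3))
      finally have "cmod (D n t) < 2"
        using elim by simp
      then show ?case
        using abs_Im_le_cmod[of "D n t"] pi_gt3 by (intro Ln_exp) auto
    qed
    moreover have "(\<lambda>n. Ln (exp (D n t))) \<longlonglongrightarrow> Ln 1"
      by (intro tendsto_Ln exp st(2)) auto
    ultimately have "(\<lambda>n. D n t) \<longlonglongrightarrow> Ln 1"
      by (rule Lim_transform_eventually[rotated])
    then show ?case
      by (simp add: t_def)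
  qed (simp add: D_0)
  from this[of N] N(2) show ?thesis
    by simp
qed

text \<open>The bound \<open>A\<close> on the masses makes the exponents equi-Lipschitz along the segment from 0 to \<open>u\<close>.\<close>

lemma psi_tendsto_of_exp_psi:
  assumes \<mu>: "\<And>n. finite_borel_measure (\<mu> n)" and M: "finite_borel_measure M"
    and mass: "\<And>n. measure (\<mu> n) UNIV \<le> A"
    and exp: "\<And>u. (\<lambda>n. exp (psi (\<mu> n) u)) \<longlonglongrightarrow> exp (psi M u)"
  shows "(\<lambda>n. psi (\<mu> n) u) \<longlonglongrightarrow> psi M u"
proof -
  interpret \<mu>: finite_borel_measure "\<mu> n" for n by (rule \<mu>)
  interpret M: finite_borel_measure M by (rule M)
  define D where "D n s = psi (\<mu> n) (s * u) - psi M (s * u)" for n s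
  have lip: "cmod (psi N (s * u) - psi N (t * u)) \<le> A' * (2 * u\<^sup>2 * \<bar>s - t\<bar>)"
    if N: "finite_borel_measure N" "measure N UNIV \<le> A'" and st: "s \<in> {0..1}" "t \<in> {0..1}" for N A' s t
  proof -
    interpret N: finite_borel_measure N by (rule N)
    have "cmod (psi N (s * u) - psi N (t * u)) \<le>
       measure N UNIV * (\<bar>s * u - t * u\<bar> * (\<bar>s * u - t * u\<bar> / 2 + \<bar>t * u\<bar>))"
      by (rule N.psi_lipschitz)
    also have "\<dots> = measure N UNIV * ((\<bar>s - t\<bar> / 2 + \<bar>t\<bar>) * (u\<^sup>2 * \<bar>s - t\<bar>))"
    proof -
      have "\<bar>s * u - t * u\<bar> = \<bar>s - t\<bar> * \<bar>u\<bar>"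
        by (metis abs_mult left_diff_distrib)
      moreover have "u\<^sup>2 = \<bar>u\<bar> * \<bar>u\<bar>"
        by (simp add: power2_eq_square)
      moreover have "m * (d * a * (d * a / 2 + b * a)) = m * ((d / 2 + b) * (a * a * d))" for m d a b :: real
        by (simp add: algebra_simps)
      ultimately show ?thesis
        by (simp only: abs_mult[of t u])
    qed
    also have "\<dots> \<le> A' * (2 * (u\<^sup>2 * \<bar>s - t\<bar>))"
    proof (intro mult_mono)
      show "\<bar>s - t\<bar> / 2 + \<bar>t\<bar> \<le> 2"
        using st by (simp add: abs_if field_simps)
    qed (use N(2) order_trans[OF measure_nonneg N(2)] in auto)
    finally show ?thesis
      by (simp add: mult.assoc)
  qed
  have "(\<lambda>n. D n 1) \<longlonglongrightarrow> 0"
  proof (rule exp_tendsto_1_imp_tendsto_0)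
    show "D n 0 = 0" for n
      by (simp add: D_def \<mu>.psi_0 M.psi_0)
    show "(\<lambda>n. exp (D n s)) \<longlonglongrightarrow> 1" for s
      using tendsto_divide[OF exp[of "s * u"] tendsto_const[of "exp (psi M (s * u))"]]
      by (simp add: D_def exp_diff)
    show "cmod (D n s - D n t) \<le> ((A + measure M UNIV) * (2 * u\<^sup>2)) * \<bar>s - t\<bar>"
      if "s \<in> {0..1}" "t \<in> {0..1}" for n s t
    proof -
      have "cmod (D n s - D n t) =
          cmod ((psi (\<mu> n) (s * u) - psi (\<mu> n) (t * u)) - (psi M (s * u) - psi M (t * u)))"
        by (simp add: D_def algebra_simps)
      also have "\<dots> \<le> A * (2 * u\<^sup>2 * \<bar>s - t\<bar>) + measure M UNIV * (2 * u\<^sup>2 * \<bar>s - t\<bar>)"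
        by (intro order_trans[OF norm_triangle_ineq4] add_mono lip \<mu> M mass that order_refl)
      finally show ?thesis
        by (simp add: algebra_simps)
    qed
  qed
  then show ?thesis
    by (simp add: D_def LIM_zero_iff)
qed

section \<open>Recovering the spectral measure\<close>

lemma (in finite_borel_measure) finite_borel_measure_fejer:
  "finite_borel_measure (density M (\<lambda>x. ennreal (fejer h x)))"
proof -
  have "emeasure (density M (\<lambda>x. ennreal (fejer h x))) UNIV = (\<integral>\<^sup>+x. ennreal (fejer h x) \<partial>M)"
    by (subst emeasure_density) (auto simp: measurable_cong_sets[OF M_is_borel refl] M_is_borel)
  also have "\<dots> \<le> (\<integral>\<^sup>+x. ennreal (h\<^sup>2) \<partial>M)"
    by (intro nn_integral_mono ennreal_leI fejer_le)
  also have "\<dots> < \<infinity>"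
    by (simp add: emeasure_eq_measure ennreal_mult_less_top)
  finally show ?thesis
    by (intro finite_borel_measure.intro finite_measureI finite_borel_measure_axioms.intro)
       (auto simp: borel_UNIV M_is_borel)
qed

lemma (in finite_borel_measure) integral_fejer:
  fixes f :: "real \<Rightarrow> 'b::{banach, second_countable_topology}"
  assumes "f \<in> borel_measurable borel"
  shows "integral\<^sup>L (density M (\<lambda>x. ennreal (fejer h x))) f = (LINT x|M. fejer h x *\<^sub>R f x)"
  using assms fejer_nonneg by (subst integral_density) (auto simp: measurable_cong_sets[OF M_is_borel refl])

lemma (in finite_borel_measure) char_fejer:
  "char (density M (\<lambda>x. ennreal (fejer h x))) u = - (psi M (u + h) + psi M (u - h) - 2 * psi M u)"
  by (simp add: char_def integral_fejer psi_second_difference scaleR_conv_of_real)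

text \<open>The cost of inserting the weight \<open>fejer h / h\<^sup>2\<close> is measured by the mass it removes, whatever the
  function \<open>f\<close>; so it can be controlled along a sequence of measures by testing with constants only.\<close>

lemma (in finite_borel_measure) integral_fejer_error:
  fixes f :: "real \<Rightarrow> real"
  assumes f: "f \<in> borel_measurable borel" "\<And>x. \<bar>f x\<bar> \<le> B"
  shows "\<bar>(LINT x|M. f x) - (LINT x|M. fejer h x * f x) / h\<^sup>2\<bar> \<le>
    B * (measure M UNIV - (LINT x|M. fejer h x / h\<^sup>2))"
proof -
  have B: "0 \<le> B"
    using f(2)[of 0] by linarith
  have i1: "integrable M f"
    by (rule integrable_bounded[where B=B]) (use f in auto)
  have i2: "integrable M (\<lambda>x. fejer h x / h\<^sup>2)"
    by (rule integrable_bounded[where B=1]) (use fejer_ratio_bounds fejer_nonneg in auto)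
  have i3: "integrable M (\<lambda>x. fejer h x / h\<^sup>2 * f x)"
  proof (rule integrable_bounded[where B="1 * B"])
    show "norm (fejer h x / h\<^sup>2 * f x) \<le> 1 * B" for x
      unfolding norm_mult using f(2)[of x] fejer_ratio_bounds[of h x] by (intro mult_mono) auto
  qed (use f in measurable)
  have "(LINT x|M. f x) - (LINT x|M. fejer h x * f x) / h\<^sup>2 = (LINT x|M. f x - fejer h x / h\<^sup>2 * f x)"
    using i1 i3 by simp
  also have "norm \<dots> \<le> (LINT x|M. B * (1 - fejer h x / h\<^sup>2))"
  proof (rule norm_integral_le_integral)
    fix x
    have "f x - fejer h x / h\<^sup>2 * f x = f x * (1 - fejer h x / h\<^sup>2)"
      by (simp add: algebra_simps)
    also have "norm \<dots> \<le> B * (1 - fejer h x / h\<^sup>2)"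
      unfolding norm_mult using f(2)[of x] fejer_ratio_bounds[of h x] B by (intro mult_mono) auto
    finally show "norm (f x - fejer h x / h\<^sup>2 * f x) \<le> B * (1 - fejer h x / h\<^sup>2)" .
  qed (use i1 i2 i3 in auto)
  also have "\<dots> = B * (measure M UNIV - (LINT x|M. fejer h x / h\<^sup>2))"
    using i2 by (simp add: borel_UNIV)
  finally show ?thesis
    by simp
qed

text \<open>Convergence of the masses is essential: \<open>kern u\<close> vanishes at infinity, so the exponents do not see
  mass that escapes.\<close>

lemma weak_conv_of_exp_psi:
  fixes f :: "real \<Rightarrow> real"
  assumes \<mu>: "\<And>n. finite_borel_measure (\<mu> n)" and M: "finite_borel_measure M"
    and mass: "(\<lambda>n. measure (\<mu> n) UNIV) \<longlonglongrightarrow> measure M UNIV"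
    and exp: "\<And>u. (\<lambda>n. exp (psi (\<mu> n) u)) \<longlonglongrightarrow> exp (psi M u)"
    and f: "\<And>x. isCont f x" "\<And>x. \<bar>f x\<bar> \<le> B"
  shows "(\<lambda>n. integral\<^sup>L (\<mu> n) f) \<longlonglongrightarrow> integral\<^sup>L M f"
proof -
  interpret \<mu>: finite_borel_measure "\<mu> n" for n by (rule \<mu>)
  interpret M: finite_borel_measure M by (rule M)
  have f_borel: "f \<in> borel_measurable borel"
    using f(1) by (intro borel_measurable_continuous_onI continuous_at_imp_continuous_on) auto
  obtain A where "\<And>n. norm (measure (\<mu> n) UNIV) \<le> A"
    using mass by (meson BseqE convergentI convergent_imp_Bseq)
  then have psi: "(\<lambda>n. psi (\<mu> n) u) \<longlonglongrightarrow> psi M u" for u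
    by (intro psi_tendsto_of_exp_psi[OF \<mu> M _ exp, where A=A]) (auto simp: abs_le_iff)
  have fejer: "(\<lambda>n. LINT x|\<mu> n. fejer h x * g x) \<longlonglongrightarrow> (LINT x|M. fejer h x * g x)"
    if g: "\<And>x. isCont g x" "\<And>x. \<bar>g x\<bar> \<le> B'" for h g B'
  proof -
    have g_borel: "g \<in> borel_measurable borel"
      using g(1) by (intro borel_measurable_continuous_onI continuous_at_imp_continuous_on) auto
    have "(\<lambda>n. integral\<^sup>L (density (\<mu> n) (\<lambda>x. ennreal (fejer h x))) g) \<longlonglongrightarrow>
        integral\<^sup>L (density M (\<lambda>x. ennreal (fejer h x))) g"
      by (rule levy_continuity_finite[OF \<mu>.finite_borel_measure_fejer M.finite_borel_measure_fejer _ g])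
         (auto simp: \<mu>.char_fejer M.char_fejer intro!: tendsto_intros psi)
    then show ?thesis
      by (simp add: \<mu>.integral_fejer M.integral_fejer g_borel)
  qed
  show ?thesis
  proof (rule tendstoI)
    fix e :: real
    assume e: "e > 0"
    define R where "R N h = B * (measure N UNIV - (LINT x|N. fejer h x / h\<^sup>2))" for N h
    have "(\<lambda>j. R M (inverse (real (Suc j)))) \<longlonglongrightarrow> B * (measure M UNIV - measure M UNIV)"
      unfolding R_def
      by (intro tendsto_intros M.integral_fejer_ratio_tendsto LIMSEQ_inverse_real_of_nat) auto
    then have "\<forall>\<^sub>F j in sequentially. R M (inverse (real (Suc j))) < e / 3"
      using e by (intro order_tendstoD(2)) auto
    then obtain h where h: "R M h < e / 3" "h \<noteq> 0"
      by (force simp: eventually_sequentially)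
    have "(\<lambda>n. LINT x|\<mu> n. fejer h x / h\<^sup>2) \<longlonglongrightarrow> (LINT x|M. fejer h x / h\<^sup>2)"
      using fejer[of "\<lambda>_. 1 / h\<^sup>2" "\<bar>1 / h\<^sup>2\<bar>" h] by simp
    then have "(\<lambda>n. R (\<mu> n) h) \<longlonglongrightarrow> R M h"
      unfolding R_def by (intro tendsto_intros mass)
    then have 1: "\<forall>\<^sub>F n in sequentially. R (\<mu> n) h < e / 3"
      using h(1) by (rule order_tendstoD(2))
    have 2: "\<forall>\<^sub>F n in sequentially.
        dist ((LINT x|\<mu> n. fejer h x * f x) / h\<^sup>2) ((LINT x|M. fejer h x * f x) / h\<^sup>2) < e / 3"
      by (intro tendstoD tendsto_divide fejer[OF f] tendsto_const) (use e h in auto)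
    from 1 2 show "\<forall>\<^sub>F n in sequentially. dist (integral\<^sup>L (\<mu> n) f) (integral\<^sup>L M f) < e"
    proof eventually_elim
      case (elim n)
      then show ?case
        using \<mu>.integral_fejer_error[OF f_borel f(2), of n h] M.integral_fejer_error[OF f_borel f(2), of h] h
        unfolding R_def dist_real_def by linarith
    qed
  qed
qed

section \<open>The variance of the limit law\<close>

text \<open>Along a sequence \<open>h j\<close> tending to 0, the remainder in the Taylor expansion of the characteristic
  function is \<open>o(h\<^sup>2)\<close> by dominated convergence, with \<open>6 Y\<^sup>2\<close> as dominating function.\<close>

lemma (in prob_space) char_second_order:
  assumes Y: "random_variable borel Y" "integrable M (\<lambda>\<omega>. (Y \<omega>)\<^sup>2)" "expectation Y = 0"
    and h: "h \<longlonglongrightarrow> 0" "\<And>j. h j \<noteq> 0"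
  shows "(\<lambda>j. (char (distr M borel Y) (h j) - 1) / complex_of_real ((h j)\<^sup>2)) \<longlonglongrightarrow>
    - complex_of_real (variance Y / 2)"
proof -
  note [measurable] = Y(1)
  have int: "integrable M Y"
    by (rule square_integrable_imp_integrable[OF Y(1,2)])
  have "(\<lambda>j. expectation (\<lambda>\<omega>. min (6 * (Y \<omega>)\<^sup>2) (\<bar>h j\<bar> * \<bar>Y \<omega>\<bar> ^ 3))) \<longlonglongrightarrow> expectation (\<lambda>_. 0)"
  proof (rule integral_dominated_convergence[where w="\<lambda>\<omega>. 6 * (Y \<omega>)\<^sup>2"])
    show "AE \<omega> in M. (\<lambda>j. min (6 * (Y \<omega>)\<^sup>2) (\<bar>h j\<bar> * \<bar>Y \<omega>\<bar> ^ 3)) \<longlonglongrightarrow> 0"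
      using h(1) by (intro AE_I2) (auto intro!: tendsto_eq_intros)
  qed (use Y in auto)
  then have lim: "(\<lambda>j. expectation (\<lambda>\<omega>. min (6 * (Y \<omega>)\<^sup>2) (\<bar>h j\<bar> * \<bar>Y \<omega>\<bar> ^ 3)) / 6) \<longlonglongrightarrow> 0"
    by (auto intro!: tendsto_eq_intros)
  have "(\<lambda>j. (char (distr M borel Y) (h j) - 1) / complex_of_real ((h j)\<^sup>2) + complex_of_real (variance Y / 2)) \<longlonglongrightarrow> 0"
  proof (rule Lim_null_comparison[OF always_eventually lim], rule allI)
    fix j
    have "(char (distr M borel Y) (h j) - 1) / complex_of_real ((h j)\<^sup>2) + complex_of_real (variance Y / 2) =
      (char (distr M borel Y) (h j) - complex_of_real (1 - (h j)\<^sup>2 * variance Y / 2)) / complex_of_real ((h j)\<^sup>2)"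
      using h(2)[of j] by (simp add: field_simps)
    then have "cmod ((char (distr M borel Y) (h j) - 1) / complex_of_real ((h j)\<^sup>2) + complex_of_real (variance Y / 2)) =
      cmod (char (distr M borel Y) (h j) - complex_of_real (1 - (h j)\<^sup>2 * variance Y / 2)) / (h j)\<^sup>2"
      by (simp only: norm_divide norm_of_real abs_power2)
    also have "\<dots> \<le> ((h j)\<^sup>2 / 6 * expectation (\<lambda>\<omega>. min (6 * (Y \<omega>)\<^sup>2) (\<bar>h j\<bar> * \<bar>Y \<omega>\<bar> ^ 3))) / (h j)\<^sup>2"
      using char_approx3'[OF Y(1) int Y(2,3) refl refl, of "h j"] by (intro divide_right_mono) auto
    finally show "norm ((char (distr M borel Y) (h j) - 1) / complex_of_real ((h j)\<^sup>2) + complex_of_real (variance Y / 2)) \<le>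
        expectation (\<lambda>\<omega>. min (6 * (Y \<omega>)\<^sup>2) (\<bar>h j\<bar> * \<bar>Y \<omega>\<bar> ^ 3)) / 6"
      using h(2)[of j] by simp
  qed
  from tendsto_diff[OF this tendsto_const[of "complex_of_real (variance Y / 2)"]] show ?thesis
    by simp
qed

text \<open>Both numbers are the limit of \<open>(1 - \<bar>\<phi>(h)\<bar>\<^sup>2) / h\<^sup>2\<close> as \<open>h \<longlonglongrightarrow> 0\<close>, where \<open>\<phi>\<close> is the
  characteristic function of \<open>Z\<close>. The modulus does not change when \<open>Z\<close> is centered, so the second order
  expansion gives the variance. On the other side \<open>\<bar>\<phi>(h)\<bar>\<^sup>2 = \<phi>(h) \<phi>(-h)\<close> is \<open>exp\<close> of minus the
  integral of \<open>fejer h\<close>, which is asymptotic to \<open>h\<^sup>2\<close> times the mass of \<open>\<mu>\<close>.\<close>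

lemma (in prob_space) variance_eq_mass:
  assumes Z: "random_variable borel Z" "integrable M (\<lambda>\<omega>. (Z \<omega>)\<^sup>2)"
    and \<mu>: "finite_borel_measure \<mu>"
    and char: "\<And>u. char (distr M borel Z) u = exp (psi \<mu> u)"
  shows "variance Z = measure \<mu> UNIV"
proof -
  interpret \<mu>: finite_borel_measure \<mu> by (rule \<mu>)
  note [measurable] = Z(1)
  have int: "integrable M Z"
    by (rule square_integrable_imp_integrable[OF Z])
  define Y where "Y \<omega> = Z \<omega> - expectation Z" for \<omega>
  define \<phi> where "\<phi> = char (distr M borel Y)"
  define h where "h j = inverse (real (Suc j))" for j
  define W where "W j = (LINT x|\<mu>. fejer (h j) x)" for j
  have h: "h \<longlonglongrightarrow> 0" "\<And>j. h j \<noteq> 0"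
    using LIMSEQ_inverse_real_of_nat by (auto simp: h_def[abs_def])
  have Y[measurable]: "random_variable borel Y" and Y2: "integrable M (\<lambda>\<omega>. (Y \<omega>)\<^sup>2)" and Y0: "expectation Y = 0"
    using Z int by (auto simp: Y_def[abs_def] power2_diff prob_space)
  have var: "variance Y = variance Z"
    using Y0 by (simp add: Y_def)
  interpret Yd: real_distribution "distr M borel Y"
    by simp
  have \<phi>_1: "(\<lambda>j. \<phi> (- h j)) \<longlonglongrightarrow> 1"
    using isCont_tendsto_compose[OF Yd.isCont_char[of 0], of "\<lambda>j. - h j" sequentially] tendsto_minus[OF h(1)]
    by (simp add: \<phi>_def Yd.char_zero)
  have "(\<lambda>j. \<phi> (- h j) * ((\<phi> (h j) - 1) / complex_of_real ((h j)\<^sup>2)) + (\<phi> (- h j) - 1) / complex_of_real ((- h j)\<^sup>2))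
      \<longlonglongrightarrow> 1 * (- complex_of_real (variance Z / 2)) + (- complex_of_real (variance Z / 2))"
  proof (rule tendsto_add[OF tendsto_mult[OF \<phi>_1]])
    show "(\<lambda>j. (\<phi> (h j) - 1) / complex_of_real ((h j)\<^sup>2)) \<longlonglongrightarrow> - complex_of_real (variance Z / 2)"
      unfolding \<phi>_def var[symmetric] by (rule char_second_order[OF Y Y2 Y0 h])
    show "(\<lambda>j. (\<phi> (- h j) - 1) / complex_of_real ((- h j)\<^sup>2)) \<longlonglongrightarrow> - complex_of_real (variance Z / 2)"
      unfolding \<phi>_def var[symmetric]
      using tendsto_minus[OF h(1)] h(2) by (intro char_second_order[OF Y Y2 Y0]) auto
  qed
  moreover have "\<phi> (- h j) * ((\<phi> (h j) - 1) / complex_of_real ((h j)\<^sup>2)) + (\<phi> (- h j) - 1) / complex_of_real ((- h j)\<^sup>2) =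
      (\<phi> (h j) * \<phi> (- h j) - 1) / complex_of_real ((h j)\<^sup>2)" for j
    by (simp add: right_diff_distrib diff_divide_distrib mult.commute)
  ultimately have 1: "(\<lambda>j. (\<phi> (h j) * \<phi> (- h j) - 1) / complex_of_real ((h j)\<^sup>2)) \<longlonglongrightarrow> - complex_of_real (variance Z)"
    by (simp only: mult_1_left) (simp flip: of_real_add)
  have \<phi>_Z: "\<phi> u = iexp (- (u * expectation Z)) * char (distr M borel Z) u" for u
    by (simp add: \<phi>_def char_def integral_distr Y_def right_diff_distrib exp_diff exp_minus divide_inverse
        mult.commute)
  have "\<phi> (h j) * \<phi> (- h j) = complex_of_real (exp (- W j))" for j
  proof -
    have "\<phi> (h j) * \<phi> (- h j) = exp (psi \<mu> (h j) + psi \<mu> (- h j))"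
      by (simp add: \<phi>_Z char exp_add exp_minus)
    also have "psi \<mu> (h j) + psi \<mu> (- h j) = - complex_of_real (W j)"
      using \<mu>.psi_second_difference[of 0 "h j"] by (simp add: \<mu>.psi_0 W_def)
    finally show ?thesis
      by (simp add: exp_of_real flip: of_real_minus)
  qed
  then have "(\<lambda>j. complex_of_real ((exp (- W j) - 1) / (h j)\<^sup>2)) \<longlonglongrightarrow> complex_of_real (- variance Z)"
    using 1 by simp
  then have 2: "(\<lambda>j. (exp (- W j) - 1) / (h j)\<^sup>2) \<longlonglongrightarrow> - variance Z"
    by (simp only: tendsto_of_real_iff)
  have W_nonneg: "W j \<ge> 0" for j
    by (simp add: W_def fejer_nonneg)
  have W_ratio: "(\<lambda>j. W j / (h j)\<^sup>2) \<longlonglongrightarrow> measure \<mu> UNIV"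
    using \<mu>.integral_fejer_ratio_tendsto[OF h] by (simp add: W_def)
  have "(\<lambda>j. W j / (h j)\<^sup>2 * (h j)\<^sup>2) \<longlonglongrightarrow> measure \<mu> UNIV * 0\<^sup>2"
    by (intro tendsto_intros W_ratio h)
  then have W_0: "W \<longlonglongrightarrow> 0"
    using h(2) by simp
  have 3: "(\<lambda>j. (exp (- W j) - 1) / (h j)\<^sup>2) \<longlonglongrightarrow> - measure \<mu> UNIV"
  proof (rule tendsto_sandwich)
    show "(\<lambda>j. - (W j / (h j)\<^sup>2)) \<longlonglongrightarrow> - measure \<mu> UNIV"
      by (intro tendsto_intros W_ratio)
    show "(\<lambda>j. - (W j / (h j)\<^sup>2 / (1 + W j))) \<longlonglongrightarrow> - measure \<mu> UNIV"
      using tendsto_minus[OF tendsto_divide[OF W_ratio tendsto_add[OF tendsto_const[of 1] W_0]]] by simp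
    \<comment> \<open>\<open>exp (- W)\<close> lies between \<open>1 - W\<close> and \<open>1 / (1 + W)\<close>.\<close>
    have "- (W j) / (h j)\<^sup>2 \<le> (exp (- W j) - 1) / (h j)\<^sup>2" for j
      using exp_ge_add_one_self[of "- W j"] by (intro divide_right_mono) auto
    then show "\<forall>\<^sub>F j in sequentially. - (W j / (h j)\<^sup>2) \<le> (exp (- W j) - 1) / (h j)\<^sup>2"
      by simp
    have "(exp (- W j) - 1) / (h j)\<^sup>2 \<le> - (W j / (1 + W j)) / (h j)\<^sup>2" for j
    proof (intro divide_right_mono)
      have "exp (- W j) \<le> inverse (1 + W j)"
        unfolding exp_minus using W_nonneg[of j] by (intro le_imp_inverse_le exp_ge_add_one_self) auto
      also have "inverse (1 + W j) = 1 - W j / (1 + W j)"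
        using W_nonneg[of j] by (simp add: field_simps)
      finally show "exp (- W j) - 1 \<le> - (W j / (1 + W j))"
        by simp
    qed simp
    then show "\<forall>\<^sub>F j in sequentially. (exp (- W j) - 1) / (h j)\<^sup>2 \<le> - (W j / (h j)\<^sup>2 / (1 + W j))"
      by (simp add: mult.commute)
  qed
  show ?thesis
    using LIMSEQ_unique[OF 2 3] by simp
qed

section \<open>The spectral measure of a row\<close>

lemma (in finite_borel_measure) interval_measure_cdf: "interval_measure (cdf M) = M"
proof (rule cdf_unique')
  show "finite_borel_measure (interval_measure (cdf M))"
    by (rule finite_borel_measure_interval_measure[OF cdf_nondecreasing cdf_is_right_cont cdf_lim_at_bot
          cdf_lim_at_top]) simp_all
  show "cdf (interval_measure (cdf M)) = cdf M"
    by (rule cdf_interval_measure[OF cdf_nondecreasing cdf_is_right_cont cdf_lim_at_bot])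
qed unfold_locales

lemma finite_borel_measure_distribution_function:
  assumes "distribution_function K"
  shows "finite_borel_measure (interval_measure K)"
proof -
  have K: "\<And>x y. x \<le> y \<Longrightarrow> K x \<le> K y" "\<And>x. continuous (at_right x) K"
    using assms by (auto simp: distribution_function_def mono_def)
  obtain B where B: "\<And>x. \<bar>K x\<bar> \<le> B"
    using assms by (auto simp: distribution_function_def bounded_iff)
  have "emeasure (interval_measure K) (\<Union>i::nat. {- real i<..real i}) =
      (SUP i. emeasure (interval_measure K) {- real (i::nat)<..real i})"
    by (rule SUP_emeasure_incseq[symmetric]) (auto simp: incseq_def)
  also have "\<dots> \<le> ennreal (2 * B)"
  proof (rule SUP_least)
    fix i :: nat
    show "emeasure (interval_measure K) {- real i<..real i} \<le> ennreal (2 * B)"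
      using B[of "real i"] B[of "- real i"]
      by (subst emeasure_interval_measure_Ioc) (auto intro!: ennreal_leI simp: K)
  qed
  also have "\<dots> < \<infinity>"
    by simp
  finally have "emeasure (interval_measure K) UNIV < \<infinity>"
    by (simp add: UN_Ioc_eq_UNIV)
  then show ?thesis
    by (intro finite_borel_measure.intro finite_measureI finite_borel_measure_axioms.intro) auto
qed

context prob_space
begin

text \<open>The measure of \<open>G\<close> is the sum of the measures \<open>y\<^sup>2 dF\<^sub>k(y)\<close>. It is realised as the image, under
  \<open>(k, \<omega>) \<mapsto> Y k \<omega>\<close>, of the measure with density \<open>(Y k \<omega>)\<^sup>2\<close> on \<open>I\<close> times the probability space. This
  image has \<open>G\<close> as its cumulative distribution function, and its integrals are sums by Fubini.\<close>

lemma
  fixes Y :: "nat \<Rightarrow> 'a \<Rightarrow> real"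
  assumes I: "finite I"
    and Y: "\<And>k. k \<in> I \<Longrightarrow> random_variable borel (Y k)"
    and Y2: "\<And>k. k \<in> I \<Longrightarrow> integrable M (\<lambda>\<omega>. (Y k \<omega>)\<^sup>2)"
  defines "G \<equiv> \<lambda>x. \<Sum>k\<in>I. LINT y:{..x}|interval_measure (cdf (distr M borel (Y k))). y\<^sup>2"
  shows finite_borel_measure_row: "finite_borel_measure (interval_measure G)"
    and integral_row: "\<And>f :: real \<Rightarrow> 'c::{banach, second_countable_topology}.
      f \<in> borel_measurable borel \<Longrightarrow> bounded (range f) \<Longrightarrow>
      integral\<^sup>L (interval_measure G) f = (\<Sum>k\<in>I. expectation (\<lambda>\<omega>. (Y k \<omega>)\<^sup>2 *\<^sub>R f (Y k \<omega>)))"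
proof -
  define P where "P = count_space I \<Otimes>\<^sub>M M"
  define V where "V z = Y (fst z) (snd z)" for z
  have V[measurable]: "V \<in> borel_measurable P"
    unfolding P_def V_def
  proof (rule measurable_pair_measure_countable1)
    show "countable I"
      using I by (rule countable_finite)
  qed (use Y in simp)
  define \<nu> where "\<nu> = distr (density P (\<lambda>z. ennreal ((V z)\<^sup>2))) borel V"
  interpret count: sigma_finite_measure "count_space I"
    using I by (rule sigma_finite_measure_count_space_finite)
  interpret pair: pair_sigma_finite "count_space I" M ..
  have "emeasure \<nu> UNIV = (\<integral>\<^sup>+z. ennreal ((V z)\<^sup>2) \<partial>P)"
    unfolding \<nu>_def by (subst emeasure_distr) (auto simp: emeasure_density cong: nn_integral_cong)
  also have "\<dots> = (\<integral>\<^sup>+k. \<integral>\<^sup>+\<omega>. ennreal ((V (k, \<omega>))\<^sup>2) \<partial>M \<partial>count_space I)"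
    unfolding P_def by (rule nn_integral_fst[symmetric]) (use V in \<open>simp add: P_def\<close>)
  also have "\<dots> = (\<Sum>k\<in>I. ennreal (expectation (\<lambda>\<omega>. (Y k \<omega>)\<^sup>2)))"
    using I by (simp add: nn_integral_count_space_finite V_def nn_integral_eq_integral Y2)
  also have "\<dots> < \<infinity>"
    by (simp add: sum_ennreal)
  finally have \<nu>_fin: "finite_borel_measure \<nu>"
    by (intro finite_borel_measure.intro finite_measureI finite_borel_measure_axioms.intro) (auto simp: \<nu>_def)
  interpret \<nu>: finite_borel_measure \<nu> by (rule \<nu>_fin)
  have int_\<nu>: "integral\<^sup>L \<nu> f = (\<Sum>k\<in>I. expectation (\<lambda>\<omega>. (Y k \<omega>)\<^sup>2 *\<^sub>R f (Y k \<omega>)))"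
    if f[measurable]: "f \<in> borel_measurable borel" and b: "bounded (range f)"
    for f :: "real \<Rightarrow> 'd::{banach, second_countable_topology}"
  proof -
    obtain B where B: "\<And>x. norm (f x) \<le> B"
      using b by (auto simp: bounded_iff)
    have "integrable \<nu> f"
      using f B by (rule \<nu>.integrable_bounded)
    then have int: "integrable P (\<lambda>z. (V z)\<^sup>2 *\<^sub>R f (V z))"
      by (simp add: \<nu>_def integrable_distr_eq integrable_density)
    have "integral\<^sup>L \<nu> f = integral\<^sup>L P (\<lambda>z. (V z)\<^sup>2 *\<^sub>R f (V z))"
      by (simp add: \<nu>_def integral_distr integral_density)
    also have "\<dots> = (\<integral>k. \<integral>\<omega>. (V (k, \<omega>))\<^sup>2 *\<^sub>R f (V (k, \<omega>)) \<partial>M \<partial>count_space I)"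
      using pair.integral_fst'[OF int[unfolded P_def]] by (simp add: P_def)
    also have "\<dots> = (\<Sum>k\<in>I. expectation (\<lambda>\<omega>. (Y k \<omega>)\<^sup>2 *\<^sub>R f (Y k \<omega>)))"
      using I by (simp add: lebesgue_integral_count_space_finite V_def)
    finally show ?thesis .
  qed
  have "cdf \<nu> x = G x" for x
  proof -
    have "cdf \<nu> x = (LINT y|\<nu>. indicat_real {..x} y)"
      by (simp add: cdf_def \<nu>.borel_UNIV)
    also have "\<dots> = (\<Sum>k\<in>I. expectation (\<lambda>\<omega>. (Y k \<omega>)\<^sup>2 *\<^sub>R indicat_real {..x} (Y k \<omega>)))"
      by (rule int_\<nu>) (auto simp: bounded_iff indicator_def intro!: exI[of _ 1])
    also have "\<dots> = G x"
      unfolding G_def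
    proof (rule sum.cong[OF refl])
      fix k assume k: "k \<in> I"
      note [measurable] = Y[OF k]
      interpret Yk: real_distribution "distr M borel (Y k)"
        by simp
      show "expectation (\<lambda>\<omega>. (Y k \<omega>)\<^sup>2 *\<^sub>R indicat_real {..x} (Y k \<omega>)) =
          (LINT y:{..x}|interval_measure (cdf (distr M borel (Y k))). y\<^sup>2)"
        by (simp add: Yk.interval_measure_cdf set_lebesgue_integral_def integral_distr mult.commute)
    qed
    finally show ?thesis .
  qed
  then have "G = cdf \<nu>"
    by (simp add: fun_eq_iff)
  then have eq: "interval_measure G = \<nu>"
    by (simp add: \<nu>.interval_measure_cdf)
  show "finite_borel_measure (interval_measure G)"
    using \<nu>_fin by (simp only: eq)
  show "integral\<^sup>L (interval_measure G) f = (\<Sum>k\<in>I. expectation (\<lambda>\<omega>. (Y k \<omega>)\<^sup>2 *\<^sub>R f (Y k \<omega>)))"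
    if "f \<in> borel_measurable borel" "bounded (range f)"
    for f :: "real \<Rightarrow> 'c::{banach, second_countable_topology}"
    using int_\<nu>[OF that] by (simp only: eq)
qed

lemma char_minus_1_eq_kern:
  assumes Y: "random_variable borel Y" "integrable M (\<lambda>\<omega>. (Y \<omega>)\<^sup>2)" "expectation Y = 0"
  shows "char (distr M borel Y) u - 1 = expectation (\<lambda>\<omega>. (Y \<omega>)\<^sup>2 *\<^sub>R kern u (Y \<omega>))"
proof -
  note [measurable] = Y(1)
  have int: "integrable M Y"
    by (rule square_integrable_imp_integrable[OF Y(1,2)])
  have i: "integrable M (\<lambda>\<omega>. iexp (u * Y \<omega>))"
    by (rule integrable_const_bound[of _ 1]) auto
  have "expectation (\<lambda>\<omega>. (Y \<omega>)\<^sup>2 *\<^sub>R kern u (Y \<omega>)) =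
      expectation (\<lambda>\<omega>. iexp (u * Y \<omega>) - 1 - \<i> * complex_of_real u * complex_of_real (Y \<omega>))"
    using kern_mult_square by (intro Bochner_Integration.integral_cong) (auto simp: scaleR_conv_of_real mult_ac)
  also have "\<dots> = expectation (\<lambda>\<omega>. iexp (u * Y \<omega>)) - 1 - \<i> * complex_of_real u * complex_of_real (expectation Y)"
    using i int by (simp add: prob_space del: of_real_mult)
  also have "\<dots> = char (distr M borel Y) u - 1"
    by (simp add: Y(3) char_def integral_distr)
  finally show ?thesis
    by simp
qed

lemma norm_char_minus_1_le_variance:
  assumes Y: "random_variable borel Y" "integrable M (\<lambda>\<omega>. (Y \<omega>)\<^sup>2)" "expectation Y = 0"
  shows "cmod (char (distr M borel Y) u - 1) \<le> u\<^sup>2 / 2 * variance Y"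
proof -
  note [measurable] = Y(1)
  have bound: "norm ((Y \<omega>)\<^sup>2 *\<^sub>R kern u (Y \<omega>)) \<le> u\<^sup>2 / 2 * (Y \<omega>)\<^sup>2" for \<omega>
    using mult_left_mono[OF norm_kern_le, of "(Y \<omega>)\<^sup>2" u "Y \<omega>"] by (simp add: mult.commute)
  have "integrable M (\<lambda>\<omega>. (Y \<omega>)\<^sup>2 *\<^sub>R kern u (Y \<omega>))"
    by (rule Bochner_Integration.integrable_bound[of _ "\<lambda>\<omega>. u\<^sup>2 / 2 * (Y \<omega>)\<^sup>2"])
       (use Y(2) bound in \<open>auto intro!: AE_I2 order_trans[OF bound]\<close>)
  then have "norm (expectation (\<lambda>\<omega>. (Y \<omega>)\<^sup>2 *\<^sub>R kern u (Y \<omega>))) \<le> expectation (\<lambda>\<omega>. u\<^sup>2 / 2 * (Y \<omega>)\<^sup>2)"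
    using Y(2) bound by (intro norm_integral_le_integral) auto
  then show ?thesis
    using Y(3) by (simp add: char_minus_1_eq_kern[OF Y])
qed

text \<open>Unlike the bound by the variance, this one is uniformly small under the UAN condition, which
  does not force the individual variances to tend to 0.\<close>

lemma norm_char_minus_1_le_tail:
  assumes Y[measurable]: "random_variable borel Y" and \<epsilon>: "\<epsilon> > 0"
  shows "cmod (char (distr M borel Y) u - 1) \<le> \<bar>u\<bar> * \<epsilon> + 2 * prob {\<omega> \<in> space M. \<epsilon> \<le> \<bar>Y \<omega>\<bar>}"
proof -
  have i: "integrable M (\<lambda>\<omega>. iexp (u * Y \<omega>))"
    by (rule integrable_const_bound[of _ 1]) auto
  have ind: "integrable M (indicat_real {\<omega> \<in> space M. \<epsilon> \<le> \<bar>Y \<omega>\<bar>})"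
    by (rule integrable_const_bound[of _ 1]) (auto simp: indicator_def)
  have "char (distr M borel Y) u - 1 = expectation (\<lambda>\<omega>. iexp (u * Y \<omega>) - 1)"
    using i by (simp add: char_def integral_distr prob_space del: of_real_mult)
  also have "cmod \<dots> \<le> expectation (\<lambda>\<omega>. \<bar>u\<bar> * \<epsilon> + 2 * indicat_real {\<omega> \<in> space M. \<epsilon> \<le> \<bar>Y \<omega>\<bar>} \<omega>)"
  proof (rule norm_integral_le_integral)
    fix \<omega> assume \<omega>: "\<omega> \<in> space M"
    show "norm (iexp (u * Y \<omega>) - 1) \<le> \<bar>u\<bar> * \<epsilon> + 2 * indicator {\<omega> \<in> space M. \<epsilon> \<le> \<bar>Y \<omega>\<bar>} \<omega>"
    proof (cases "\<epsilon> \<le> \<bar>Y \<omega>\<bar>")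
      case True
      have "norm (iexp (u * Y \<omega>) - 1) \<le> 2"
        using norm_triangle_ineq4[of "iexp (u * Y \<omega>)" 1] by simp
      also have "2 \<le> \<bar>u\<bar> * \<epsilon> + 2"
        using \<epsilon> by simp
      finally show ?thesis
        using True \<omega> by simp
    next
      case False
      have "norm (iexp (u * Y \<omega>) - 1) \<le> \<bar>u\<bar> * \<bar>Y \<omega>\<bar>"
        using iexp_approx1[of "u * Y \<omega>" 0] by (simp add: abs_mult)
      also have "\<dots> \<le> \<bar>u\<bar> * \<epsilon>"
        using False by (intro mult_left_mono) auto
      finally show ?thesis
        using False by simp
    qed
  qed (use i ind in \<open>auto simp del: of_real_mult\<close>)
  also have "\<dots> = \<bar>u\<bar> * \<epsilon> + 2 * prob {\<omega> \<in> space M. \<epsilon> \<le> \<bar>Y \<omega>\<bar>}"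
    using ind by (simp add: prob_space)
  finally show ?thesis .
qed

text \<open>All the numbers \<open>\<phi>\<^sub>k\<close> and \<open>exp (\<phi>\<^sub>k - 1)\<close> lie in the unit disc, so their products differ by at most the
  sum of the differences, and each of these is at most \<open>e\<^sup>2 \<bar>\<phi>\<^sub>k - 1\<bar>\<^sup>2\<close>. One factor \<open>\<bar>\<phi>\<^sub>k - 1\<bar>\<close> is
  bounded by \<open>\<delta>\<close>, the other by the variance.\<close>

lemma char_sum_vs_exp_psi:
  fixes Y :: "nat \<Rightarrow> 'a \<Rightarrow> real"
  assumes I: "finite I"
    and Y: "\<And>k. k \<in> I \<Longrightarrow> random_variable borel (Y k)"
    and Y2: "\<And>k. k \<in> I \<Longrightarrow> integrable M (\<lambda>\<omega>. (Y k \<omega>)\<^sup>2)"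
    and Y0: "\<And>k. k \<in> I \<Longrightarrow> expectation (Y k) = 0"
    and indep: "indep_vars (\<lambda>_. borel) Y I"
    and \<delta>: "\<And>k. k \<in> I \<Longrightarrow> cmod (char (distr M borel (Y k)) u - 1) \<le> \<delta>"
  defines "G \<equiv> \<lambda>x. \<Sum>k\<in>I. LINT y:{..x}|interval_measure (cdf (distr M borel (Y k))). y\<^sup>2"
  shows "cmod (char (distr M borel (\<lambda>\<omega>. \<Sum>k\<in>I. Y k \<omega>)) u - exp (psi (interval_measure G) u)) \<le>
    exp 2 * \<delta> * (u\<^sup>2 / 2) * (\<Sum>k\<in>I. variance (Y k))"
proof -
  define \<phi> where "\<phi> k = char (distr M borel (Y k)) u" for k
  have \<phi>_1: "cmod (\<phi> k) \<le> 1" if "k \<in> I" for k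
  proof -
    interpret Yk: real_distribution "distr M borel (Y k)"
      using Y[OF that] by simp
    show ?thesis
      unfolding \<phi>_def by (rule Yk.cmod_char_le_1)
  qed
  have exp_1: "cmod (exp (\<phi> k - 1)) \<le> 1" if "k \<in> I" for k
    using complex_Re_le_cmod[of "\<phi> k"] \<phi>_1[OF that] by simp
  have "psi (interval_measure G) u = (\<Sum>k\<in>I. expectation (\<lambda>\<omega>. (Y k \<omega>)\<^sup>2 *\<^sub>R kern u (Y k \<omega>)))"
    unfolding psi_def G_def
    by (intro integral_row I Y Y2 bounded_range_kern kern_measurable)
  also have "\<dots> = (\<Sum>k\<in>I. \<phi> k - 1)"
    by (intro sum.cong) (auto simp: \<phi>_def char_minus_1_eq_kern Y Y2 Y0)
  finally have "exp (psi (interval_measure G) u) = (\<Prod>k\<in>I. exp (\<phi> k - 1))"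
    using I by (simp add: exp_sum)
  then have "cmod (char (distr M borel (\<lambda>\<omega>. \<Sum>k\<in>I. Y k \<omega>)) u - exp (psi (interval_measure G) u)) =
      cmod ((\<Prod>k\<in>I. \<phi> k) - (\<Prod>k\<in>I. exp (\<phi> k - 1)))"
    by (simp add: char_distr_sum[OF indep] \<phi>_def)
  also have "\<dots> \<le> (\<Sum>k\<in>I. cmod (\<phi> k - exp (\<phi> k - 1)))"
    by (intro norm_prod_diff \<phi>_1 exp_1)
  also have "\<dots> \<le> (\<Sum>k\<in>I. exp 2 * \<delta> * (u\<^sup>2 / 2) * variance (Y k))"
  proof (rule sum_mono)
    fix k assume k: "k \<in> I"
    define z where "z = \<phi> k - 1"
    have z: "cmod z \<le> \<delta>" "cmod z \<le> u\<^sup>2 / 2 * variance (Y k)"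
      unfolding z_def \<phi>_def using \<delta>[OF k] norm_char_minus_1_le_variance[OF Y Y2 Y0] k by auto
    have "cmod z \<le> 2"
      unfolding z_def using norm_triangle_ineq4[of "\<phi> k" 1] \<phi>_1[OF k] by simp
    then have Re: "\<bar>Re z\<bar> \<le> 2"
      using abs_Re_le_cmod[of z] by linarith
    have "cmod (\<phi> k - exp (\<phi> k - 1)) = cmod (exp z - (\<Sum>i\<le>1. z ^ i / fact i))"
      by (simp add: z_def norm_minus_commute)
    also have "\<dots> \<le> exp \<bar>Re z\<bar> * cmod z ^ Suc 1 / fact 1"
      by (rule Taylor_exp)
    also have "\<dots> = exp \<bar>Re z\<bar> * (cmod z * cmod z)"
      by simp
    also have "\<dots> \<le> exp 2 * (\<delta> * (u\<^sup>2 / 2 * variance (Y k)))"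
      using z Re order_trans[OF norm_ge_zero z(1)] by (intro mult_mono) auto
    finally show "cmod (\<phi> k - exp (\<phi> k - 1)) \<le> exp 2 * \<delta> * (u\<^sup>2 / 2) * variance (Y k)"
      by (simp add: mult.assoc)
  qed
  finally show ?thesis
    by (simp add: sum_distrib_left)
qed

end

section \<open>Rows of a uniformly negligible array\<close>

lemma UAN_max_char:
  assumes M: "\<And>n. prob_space (M n)"
    and X: "\<And>n k. k \<in> {1..m n} \<Longrightarrow> X k n \<in> borel_measurable (M n)"
    and UAN: "UAN M m X" and \<delta>: "\<delta> > 0"
  shows "\<forall>\<^sub>F n in sequentially. \<forall>k\<in>{1..m n}. cmod (char (distr (M n) borel (X k n)) u - 1) \<le> \<delta>"
proof -
  define \<epsilon> where "\<epsilon> = \<delta> / (2 * (\<bar>u\<bar> + 1))"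
  have \<epsilon>: "\<epsilon> > 0"
    using \<delta> by (simp add: \<epsilon>_def)
  have u\<epsilon>: "\<bar>u\<bar> * \<epsilon> \<le> \<delta> / 2"
    using \<delta> by (simp add: \<epsilon>_def field_simps)
  define T where "T n k = measure (M n) {\<omega> \<in> space (M n). \<bar>X k n \<omega>\<bar> \<ge> \<epsilon>}" for n k
  have "(\<lambda>n. MAX k\<in>{1..m n}. T n k) \<longlonglongrightarrow> 0"
    using UAN \<epsilon> by (simp add: UAN_def T_def)
  then have "\<forall>\<^sub>F n in sequentially. (MAX k\<in>{1..m n}. T n k) < \<delta> / 4"
    using \<delta> by (intro order_tendstoD(2)) auto
  then show ?thesis
  proof eventually_elim
    case (elim n)
    interpret prob_space "M n" by (rule M)
    show ?case
    proof
      fix k assume k: "k \<in> {1..m n}"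
      have "T n k \<le> (MAX k\<in>{1..m n}. T n k)"
        using k by (intro Max_ge) auto
      then show "cmod (char (distr (M n) borel (X k n)) u - 1) \<le> \<delta>"
        using norm_char_minus_1_le_tail[OF X[OF k] \<epsilon>, of u] elim u\<epsilon> by (simp add: T_def)
    qed
  qed
qed

lemma char_row_sum_minus_exp_psi_tendsto_0:
  assumes M: "\<And>n. prob_space (M n)"
    and X: "\<And>n k. k \<in> {1..m n} \<Longrightarrow> X k n \<in> borel_measurable (M n)"
    and X2: "\<And>n k. k \<in> {1..m n} \<Longrightarrow> integrable (M n) (\<lambda>\<omega>. (X k n \<omega>)\<^sup>2)"
    and X0: "\<And>n k. k \<in> {1..m n} \<Longrightarrow> prob_space.expectation (M n) (X k n) = 0"
    and indep: "\<And>n. prob_space.indep_vars (M n) (\<lambda>_. borel) (\<lambda>k. X k n) {1..m n}"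
    and VCH: "VCH M m X c" and UAN: "UAN M m X"
  shows "(\<lambda>n. char (distr (M n) borel (\<lambda>\<omega>. \<Sum>k=1..m n. X k n \<omega>)) u -
    exp (psi (interval_measure (row_K M m X n)) u)) \<longlonglongrightarrow> 0"
proof (rule tendstoI)
  fix e :: real
  assume e: "e > 0"
  have c: "c > 0" and var: "(\<lambda>n. \<Sum>k=1..m n. prob_space.variance (M n) (X k n)) \<longlonglongrightarrow> c"
    using VCH by (auto simp: VCH_def)
  define C where "C = exp 2 * (u\<^sup>2 / 2) * (c + 1)"
  have C: "C \<ge> 0"
    using c by (simp add: C_def)
  define \<delta> where "\<delta> = e / (C + 1)"
  have \<delta>: "\<delta> > 0" "\<delta> * C < e"
    using e C by (auto simp: \<delta>_def field_simps)
  have "\<forall>\<^sub>F n in sequentially. (\<Sum>k=1..m n. prob_space.variance (M n) (X k n)) < c + 1"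
    using var by (rule order_tendstoD(2)) simp
  moreover have "\<forall>\<^sub>F n in sequentially. \<forall>k\<in>{1..m n}. cmod (char (distr (M n) borel (X k n)) u - 1) \<le> \<delta>"
    by (rule UAN_max_char[OF M X UAN \<delta>(1)])
  ultimately show "\<forall>\<^sub>F n in sequentially.
      dist (char (distr (M n) borel (\<lambda>\<omega>. \<Sum>k=1..m n. X k n \<omega>)) u -
        exp (psi (interval_measure (row_K M m X n)) u)) 0 < e"
  proof eventually_elim
    case (elim n)
    interpret prob_space "M n" by (rule M)
    have "cmod (char (distr (M n) borel (\<lambda>\<omega>. \<Sum>k=1..m n. X k n \<omega>)) u -
        exp (psi (interval_measure (row_K M m X n)) u)) \<le>
        exp 2 * \<delta> * (u\<^sup>2 / 2) * (\<Sum>k=1..m n. variance (X k n))"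
      unfolding row_K_def[abs_def] row_cdf_def
      by (rule char_sum_vs_exp_psi) (use X X2 X0 indep elim(2) in auto)
    also have "\<dots> \<le> exp 2 * \<delta> * (u\<^sup>2 / 2) * (c + 1)"
      using elim(1) \<delta>(1) by (intro mult_left_mono) auto
    also have "\<dots> = \<delta> * C"
      by (simp add: C_def)
    finally show ?case
      using \<delta>(2) by simp
  qed
qed

lemma row_K_eq_sum:
  "row_K M m X n = (\<lambda>x. \<Sum>k\<in>{1..m n}. LINT y:{..x}|interval_measure (cdf (distr (M n) borel (X k n))). y\<^sup>2)"
  by (simp add: row_K_def row_cdf_def fun_eq_iff)

text \<open>The mass of the measure of \<open>K\<^sub>n\<close> is the variance of the row sum, so the VCH provides the convergence of
  masses that \<open>weak_conv_of_exp_psi\<close> needs.\<close>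

lemma weak_conv_iff_weak_conv_df:
  assumes M: "\<And>n. prob_space (M n)"
    and X: "\<And>n k. k \<in> {1..m n} \<Longrightarrow> X k n \<in> borel_measurable (M n)"
    and X2: "\<And>n k. k \<in> {1..m n} \<Longrightarrow> integrable (M n) (\<lambda>\<omega>. (X k n \<omega>)\<^sup>2)"
    and X0: "\<And>n k. k \<in> {1..m n} \<Longrightarrow> prob_space.expectation (M n) (X k n) = 0"
    and indep: "\<And>n. prob_space.indep_vars (M n) (\<lambda>_. borel) (\<lambda>k. X k n) {1..m n}"
    and VCH: "VCH M m X c" and UAN: "UAN M m X"
    and K: "distribution_function K" and L: "is_K_law K L"
    and mass: "measure (interval_measure K) UNIV = c"
  shows "weak_conv_m (\<lambda>n. distr (M n) borel (\<lambda>\<omega>. \<Sum>k=1..m n. X k n \<omega>)) L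
           \<longleftrightarrow> weak_conv_df (row_K M m X) K"
proof -
  define S where "S n = distr (M n) borel (\<lambda>\<omega>. \<Sum>k=1..m n. X k n \<omega>)" for n
  define \<kappa> where "\<kappa> n = interval_measure (row_K M m X n)" for n
  define \<mu> where "\<mu> = interval_measure K"
  have \<kappa>: "finite_borel_measure (\<kappa> n)" for n
    unfolding \<kappa>_def row_K_eq_sum by (intro prob_space.finite_borel_measure_row M) (use X X2 in auto)
  have \<mu>: "finite_borel_measure \<mu>"
    unfolding \<mu>_def by (rule finite_borel_measure_distribution_function[OF K])
  interpret \<kappa>: finite_borel_measure "\<kappa> n" for n by (rule \<kappa>)
  interpret \<mu>: finite_borel_measure \<mu> by (rule \<mu>)
  have S: "real_distribution (S n)" for n
  proof -
    interpret prob_space "M n" by (rule M)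
    show ?thesis
      unfolding S_def using X by (intro real_distribution_distr borel_measurable_sum) auto
  qed
  have L': "real_distribution L" "\<And>u. char L u = exp (psi \<mu> u)"
    using L by (auto simp: is_K_law_def Psi_eq_psi \<mu>_def)
  have row_mass: "measure (\<kappa> n) UNIV = (\<Sum>k=1..m n. prob_space.variance (M n) (X k n))" for n
  proof -
    interpret prob_space "M n" by (rule M)
    have "measure (\<kappa> n) UNIV = (LINT x|\<kappa> n. 1)"
      by (simp add: \<kappa>.borel_UNIV)
    also have "\<dots> = (\<Sum>k\<in>{1..m n}. expectation (\<lambda>\<omega>. (X k n \<omega>)\<^sup>2 *\<^sub>R 1))"
      unfolding \<kappa>_def row_K_eq_sum by (rule integral_row) (use X X2 in auto)
    finally show ?thesis
      using X0 by simp
  qed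
  have mass_lim: "(\<lambda>n. measure (\<kappa> n) UNIV) \<longlonglongrightarrow> measure \<mu> UNIV"
    using VCH by (simp add: row_mass VCH_def mass \<mu>_def)
  have char_lim: "(\<lambda>n. char (S n) u - exp (psi (\<kappa> n) u)) \<longlonglongrightarrow> 0" for u
    unfolding S_def \<kappa>_def by (rule char_row_sum_minus_exp_psi_tendsto_0[OF M X X2 X0 indep VCH UAN])
  have "weak_conv_m S L \<longleftrightarrow> (\<forall>u. (\<lambda>n. char (S n) u) \<longlonglongrightarrow> exp (psi \<mu> u))"
    using levy_continuity1[OF S L'(1)] levy_continuity[OF S L'(1)] by (auto simp: L'(2))
  also have "\<dots> \<longleftrightarrow> (\<forall>u. (\<lambda>n. exp (psi (\<kappa> n) u)) \<longlonglongrightarrow> exp (psi \<mu> u))"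
    by (intro all_cong1 Lim_transform_eq char_lim)
  also have "\<dots> \<longleftrightarrow> weak_conv_df (row_K M m X) K"
  proof
    assume exp: "\<forall>u. (\<lambda>n. exp (psi (\<kappa> n) u)) \<longlonglongrightarrow> exp (psi \<mu> u)"
    show "weak_conv_df (row_K M m X) K"
      unfolding weak_conv_df_def \<kappa>_def[symmetric] \<mu>_def[symmetric]
    proof (intro allI impI)
      fix f :: "real \<Rightarrow> real"
      assume f: "continuous_on UNIV f" "bounded (range f)"
      then obtain B where "\<And>x. \<bar>f x\<bar> \<le> B"
        by (auto simp: bounded_iff)
      with f(1) show "(\<lambda>n. integral\<^sup>L (\<kappa> n) f) \<longlonglongrightarrow> integral\<^sup>L \<mu> f"
        using exp by (intro weak_conv_of_exp_psi[OF \<kappa> \<mu> mass_lim, where B=B])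
          (auto simp: continuous_on_eq_continuous_at)
    qed
  next
    assume weak: "weak_conv_df (row_K M m X) K"
    show "\<forall>u. (\<lambda>n. exp (psi (\<kappa> n) u)) \<longlonglongrightarrow> exp (psi \<mu> u)"
    proof
      fix u
      have conv: "(\<lambda>n. LINT x|\<kappa> n. g (kern u x)) \<longlonglongrightarrow> (LINT x|\<mu>. g (kern u x))"
        if g: "continuous_on UNIV g" "\<And>z. \<bar>g z\<bar> \<le> cmod z" for g :: "complex \<Rightarrow> real"
      proof -
        have "continuous_on UNIV (\<lambda>x. g (kern u x))"
          using kern_isCont by (intro continuous_on_compose2[OF g(1)] continuous_at_imp_continuous_on) auto
        moreover have "bounded (range (\<lambda>x. g (kern u x)))"
          unfolding bounded_iff by (auto intro!: exI[of _ "u\<^sup>2 / 2"] order_trans[OF g(2) norm_kern_le])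
        ultimately show ?thesis
          using weak by (simp add: weak_conv_df_def \<kappa>_def \<mu>_def)
      qed
      have Re_Im: "psi N u = Complex (LINT x|N. Re (kern u x)) (LINT x|N. Im (kern u x))"
        if "finite_borel_measure N" for N
        using finite_borel_measure.integrable_kern[OF that, of u] by (simp add: psi_def complex_eq_iff)
      have "(\<lambda>n. psi (\<kappa> n) u) \<longlonglongrightarrow> psi \<mu> u"
        unfolding Re_Im[OF \<kappa>] Re_Im[OF \<mu>]
        by (intro tendsto_Complex conv continuous_intros abs_Re_le_cmod abs_Im_le_cmod)
      then show "(\<lambda>n. exp (psi (\<kappa> n) u)) \<longlonglongrightarrow> exp (psi \<mu> u)"
        by (rule tendsto_exp)
    qed
  qed
  finally show ?thesis
    by (simp only: S_def[abs_def])
qed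

theorem theorem2:
  fixes M :: "nat \<Rightarrow> 'a measure"
    and m :: "nat \<Rightarrow> nat"
    and X :: "nat \<Rightarrow> nat \<Rightarrow> 'a \<Rightarrow> real"
    and c :: real
    and K :: "real \<Rightarrow> real"
    and L :: "real measure"
    and N :: "'b measure"
    and Z :: "'b \<Rightarrow> real"
  assumes "\<And>n. n \<ge> 1 \<Longrightarrow> prob_space (M n)"
    and "\<And>n k. n \<ge> 1 \<Longrightarrow> k \<in> {1..m n} \<Longrightarrow> X k n \<in> borel_measurable (M n)"
    and "\<And>n k. n \<ge> 1 \<Longrightarrow> k \<in> {1..m n} \<Longrightarrow> integrable (M n) (\<lambda>\<omega>. (X k n \<omega>)\<^sup>2)"
    and "\<And>n k. n \<ge> 1 \<Longrightarrow> k \<in> {1..m n} \<Longrightarrow> prob_space.expectation (M n) (X k n) = 0"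
    and "\<And>n. n \<ge> 1 \<Longrightarrow> prob_space.indep_vars (M n) (\<lambda>_. borel) (\<lambda>k. X k n) {1..m n}"
    and "filterlim m at_top sequentially"
    and "VCH M m X c"
    and "UAN M m X"
    and "distribution_function K"
    and "is_K_law K L"
    and "prob_space N"
    and "Z \<in> borel_measurable N"
    and "distr N borel Z = L"
    and "integrable N (\<lambda>\<omega>. (Z \<omega>)\<^sup>2)"
    and "prob_space.variance N Z = c"
  shows "weak_conv_m (\<lambda>n. distr (M n) borel (\<lambda>\<omega>. \<Sum>k=1..m n. X k n \<omega>)) L
           \<longleftrightarrow> weak_conv_df (row_K M m X) K"
proof -
  \<comment> \<open>Nothing is known about the row with index 0, so all rows are shifted by one.\<close>
  let ?M = "\<lambda>n. M (Suc n)" and ?m = "\<lambda>n. m (Suc n)" and ?X = "\<lambda>k n. X k (Suc n)"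
  let ?S = "\<lambda>n. distr (M n) borel (\<lambda>\<omega>. \<Sum>k=1..m n. X k n \<omega>)"
  have mass: "measure (interval_measure K) UNIV = c"
    using prob_space.variance_eq_mass[OF assms(11,12,14)
        finite_borel_measure_distribution_function[OF assms(9)]] assms(10,13,15)
    by (simp add: is_K_law_def Psi_eq_psi)
  have VCH: "VCH ?M ?m ?X c"
    using assms(7) LIMSEQ_Suc[of "\<lambda>n. \<Sum>k=1..m n. prob_space.variance (M n) (X k n)" c]
    by (simp add: VCH_def)
  have UAN: "UAN ?M ?m ?X"
    unfolding UAN_def
  proof (intro allI impI)
    fix \<epsilon> :: real assume "\<epsilon> > 0"
    then have "(\<lambda>n. MAX k\<in>{1..m n}. measure (M n) {\<omega> \<in> space (M n). \<bar>X k n \<omega>\<bar> \<ge> \<epsilon>}) \<longlonglongrightarrow> 0"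
      using assms(8) by (simp add: UAN_def)
    then show "(\<lambda>n. MAX k\<in>{1..?m n}. measure (?M n) {\<omega> \<in> space (?M n). \<bar>?X k n \<omega>\<bar> \<ge> \<epsilon>}) \<longlonglongrightarrow> 0"
      by (rule LIMSEQ_Suc)
  qed
  have "weak_conv_m ?S L \<longleftrightarrow> weak_conv_m (\<lambda>n. ?S (Suc n)) L"
    unfolding weak_conv_m_def weak_conv_def by (simp only: filterlim_sequentially_Suc[of "\<lambda>n. cdf (?S n) x" for x])
  also have "\<dots> \<longleftrightarrow> weak_conv_df (row_K ?M ?m ?X) K"
    by (rule weak_conv_iff_weak_conv_df[OF _ _ _ _ _ VCH UAN assms(9,10) mass]) (use assms(1-5) in auto)
  also have "row_K ?M ?m ?X = (\<lambda>n. row_K M m X (Suc n))"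
    by (simp add: row_K_def row_cdf_def fun_eq_iff)
  also have "weak_conv_df (\<lambda>n. row_K M m X (Suc n)) K \<longleftrightarrow> weak_conv_df (row_K M m X) K"
    unfolding weak_conv_df_def
    by (simp add: filterlim_sequentially_Suc[of "\<lambda>n. integral\<^sup>L (interval_measure (row_K M m X n)) f" for f])
  finally show ?thesis .
qed

end
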